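(* Let $n\in\{1,2,3\}$, let $\Omega\subset\mathbb{R}^n$ be a bounded open connected set with Lipschitz boundary, and let $A(x,x')=\tilde A(|x-x'|)$ be a strictly positive definite kernel with $A\in L^1(\Omega\times\Omega)$. Assume that the function $d\mapsto\tilde A(|d|)$ is twice weakly differentiable on $\Omega-\Omega=\{x-x' : x,x'\in\Omega\}\subset\mathbb{R}^n$ and that the function $(x,x')\mapsto(\Delta \tilde A(|\cdot|))(x-x')$ belongs to $L^2(\Omega\times\Omega)$. Then $L^2(\Omega;\mathbb{R}^n)$ is compactly embedded in $V_A$.
   Context: $\tilde A:\mathbb{R}\to\mathbb{R}$ is an even function (defined on $[0,\infty)$ and extended evenly), and $A(x,x')=\tilde A(|x-x'|)$. The kernel $A\in L^1(\Omega\times\Omega)$ is called strictly positive definite if $\int_\Omega\int_\Omega A(x,x')\phi(x)\phi(x')\,dx'\,dx>0$ for all $\phi\in C_c^\infty(\Omega)\setminus\{0\}$ (real-valued $\phi$). For such $A$, $(u,v)_A=\int_\Omega\int_\Omega A(x,x')\,\nabla u(x):\nabla v(x')\,dx'\,dx$ is an inner product on $C_c^\infty(\Omega;\mathbb{R}^n)$, where $\alpha:\beta=\sum_{k,m}\alpha_{km}\beta_{km}$ is the Frobenius product; $\|\cdot\|_A$ is the induced norm, and $V_A$ is the Hilbert space completion of $C_c^\infty(\Omega;\mathbb{R}^n)$ with respect to it. $\Delta\tilde A(|\cdot|)$ denotes the weak Laplacian on $\Omega-\Omega$ of $d\mapsto\tilde A(|d|)$. "$L^2(\Omega;\mathbb{R}^n)$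 is compactly embedded in $V_A$" means that the identity map on $C_c^\infty(\Omega;\mathbb{R}^n)$, which is dense in both spaces, extends by continuity to a compact linear operator $L^2(\Omega;\mathbb{R}^n)\to V_A$. *)

theory Defs
  imports "HOL-Analysis.Analysis"
begin

section \<open>Test functions\<close>

text \<open>
  \<open>Ck k f\<close> says that \<open>f\<close> is \<open>k\<close> times continuously differentiable: all
  iterated directional derivatives up to order \<open>k\<close> exist and are continuous.
\<close>

primrec Ck :: "nat \<Rightarrow> ('a::euclidean_space \<Rightarrow> 'b::euclidean_space) \<Rightarrow> bool" where
  "Ck 0 f \<longleftrightarrow> continuous_on UNIV f"
| "Ck (Suc k) f \<longleftrightarrow>
     (\<forall>x. f differentiable (at x)) \<and> (\<forall>v. Ck k (\<lambda>x. frechet_derivative f (at x) v))"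

text \<open>
  Elements of \<open>C\<^sub>c\<^sup>\<infinity>(\<Omega>)\<close> are represented by their extension by zero to the whole space.
\<close>

definition test_functions ::
    "'a::euclidean_space set \<Rightarrow> ('a \<Rightarrow> 'b::euclidean_space) set" where
  "test_functions \<Omega> =
     {\<phi>. (\<forall>k. Ck k \<phi>) \<and> compact (closure {x. \<phi> x \<noteq> 0}) \<and> closure {x. \<phi> x \<noteq> 0} \<subseteq> \<Omega>}"

section \<open>Weak derivatives\<close>

definition partial_deriv ::
    "'a::euclidean_space \<Rightarrow> ('a \<Rightarrow> real) \<Rightarrow> 'a \<Rightarrow> real" where
  "partial_deriv b f x = frechet_derivative f (at x) b"

definition laplacian :: "('a::euclidean_space \<Rightarrow> real) \<Rightarrow> 'a \<Rightarrow> real" where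
  "laplacian f x = (\<Sum>b\<in>Basis. partial_deriv b (partial_deriv b f) x)"

definition locally_integrable_on ::
    "('a::euclidean_space \<Rightarrow> real) \<Rightarrow> 'a set \<Rightarrow> bool"  (infix "locally'_integrable'_on" 50) where
  "f locally_integrable_on U \<longleftrightarrow>
     (\<forall>K. compact K \<and> K \<subseteq> U \<longrightarrow> integrable (lebesgue_on K) f)"

definition has_weak_partial ::
    "'a::euclidean_space set \<Rightarrow> 'a \<Rightarrow> ('a \<Rightarrow> real) \<Rightarrow> ('a \<Rightarrow> real) \<Rightarrow> bool" where
  "has_weak_partial U b f g \<longleftrightarrow>
     f locally_integrable_on U \<and> g locally_integrable_on U \<and>
     (\<forall>\<phi>\<in>test_functions U.
        (LINT x|lebesgue_on U. f x * partial_deriv b \<phi> x) = - (LINT x|lebesgue_on U. g x * \<phi> x))"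

definition twice_weakly_differentiable_on ::
    "'a::euclidean_space set \<Rightarrow> ('a \<Rightarrow> real) \<Rightarrow> bool" where
  "twice_weakly_differentiable_on U f \<longleftrightarrow>
     (\<forall>b\<in>Basis. \<exists>g. has_weak_partial U b f g \<and> (\<forall>c\<in>Basis. \<exists>h. has_weak_partial U c g h))"

definition has_weak_laplacian ::
    "'a::euclidean_space set \<Rightarrow> ('a \<Rightarrow> real) \<Rightarrow> ('a \<Rightarrow> real) \<Rightarrow> bool" where
  "has_weak_laplacian U f L \<longleftrightarrow>
     f locally_integrable_on U \<and> L locally_integrable_on U \<and>
     (\<forall>\<phi>\<in>test_functions U.
        (LINT x|lebesgue_on U. f x * laplacian \<phi> x) = (LINT x|lebesgue_on U. L x * \<phi> x))"

section \<open>Lipschitz domains\<close>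

text \<open>
  Near each boundary point, after a rotation taking the last coordinate axis to the unit
  vector \<open>\<nu>\<close>, the set is the strict epigraph of a Lipschitz function \<open>\<gamma>\<close> on the
  hyperplane orthogonal to \<open>\<nu>\<close>; \<open>y - (y \<bullet> \<nu>) *\<^sub>R \<nu>\<close> is the projection of \<open>y\<close> to it.
\<close>

definition lipschitz_boundary :: "'a::euclidean_space set \<Rightarrow> bool" where
  "lipschitz_boundary \<Omega> \<longleftrightarrow>
     (\<forall>p\<in>frontier \<Omega>. \<exists>r>0. \<exists>\<nu> L (\<gamma>::'a \<Rightarrow> real).
        norm \<nu> = 1 \<and> L-lipschitz_on {z. z \<bullet> \<nu> = 0} \<gamma> \<and>
        \<Omega> \<inter> ball p r = {y \<in> ball p r. \<gamma> (y - (y \<bullet> \<nu>) *\<^sub>R \<nu>) < y \<bullet> \<nu>})"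

section \<open>The space of square-integrable functions\<close>

text \<open>Functions are not identified here when they agree almost everywhere.\<close>

definition L2 :: "'a::euclidean_space set \<Rightarrow> ('a \<Rightarrow> 'b::euclidean_space) set" where
  "L2 \<Omega> = {f. f \<in> borel_measurable (lebesgue_on \<Omega>) \<and>
               integrable (lebesgue_on \<Omega>) (\<lambda>x. (norm (f x))\<^sup>2)}"

definition L2_norm_on :: "'a::euclidean_space set \<Rightarrow> ('a \<Rightarrow> 'b::euclidean_space) \<Rightarrow> real" where
  "L2_norm_on \<Omega> f = sqrt (LINT x|lebesgue_on \<Omega>. (norm (f x))\<^sup>2)"

text \<open>
  A compact linear operator from \<open>L\<^sup>2\<close> to a normed space. The first clause makes it an
  operator on classes of functions modulo equality almost everywhere.
\<close>

definition compact_operator_on_L2 ::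
    "'a::euclidean_space set \<Rightarrow> (('a \<Rightarrow> 'b::euclidean_space) \<Rightarrow> 'h::real_normed_vector) \<Rightarrow> bool" where
  "compact_operator_on_L2 \<Omega> T \<longleftrightarrow>
     (\<forall>f\<in>L2 \<Omega>. \<forall>g\<in>L2 \<Omega>. (AE x in lebesgue_on \<Omega>. f x = g x) \<longrightarrow> T f = T g) \<and>
     (\<forall>f\<in>L2 \<Omega>. \<forall>g\<in>L2 \<Omega>. T (\<lambda>x. f x + g x) = T f + T g) \<and>
     (\<forall>c. \<forall>f\<in>L2 \<Omega>. T (\<lambda>x. c *\<^sub>R f x) = c *\<^sub>R T f) \<and>
     (\<forall>B C. B \<subseteq> L2 \<Omega> \<and> (\<forall>f\<in>B. L2_norm_on \<Omega> f \<le> C) \<longrightarrow> compact (closure (T ` B)))"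

section \<open>The energy space of a kernel\<close>

definition strictly_positive_definite ::
    "'a::euclidean_space set \<Rightarrow> ('a \<Rightarrow> 'a \<Rightarrow> real) \<Rightarrow> bool" where
  "strictly_positive_definite \<Omega> A \<longleftrightarrow>
     (\<forall>\<phi>::'a \<Rightarrow> real. \<phi> \<in> test_functions \<Omega> \<and> \<phi> \<noteq> (\<lambda>x. 0) \<longrightarrow>
        (LINT x|lebesgue_on \<Omega>. LINT x'|lebesgue_on \<Omega>. A x x' * \<phi> x * \<phi> x') > 0)"

text \<open>
  The entry \<open>(k, m)\<close> of \<open>jacobian u (at x)\<close> is the partial derivative of \<open>u\<^sub>k\<close> in
  direction \<open>m\<close>; the inner product on \<open>real^'n^'n\<close> is the Frobenius product.
\<close>

definition kernel_inner ::
    "(real^'n) set \<Rightarrow> (real^'n \<Rightarrow> real^'n \<Rightarrow> real) \<Rightarrow>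
     (real^'n \<Rightarrow> real^'n) \<Rightarrow> (real^'n \<Rightarrow> real^'n) \<Rightarrow> real" where
  "kernel_inner \<Omega> A u v =
     (LINT x|lebesgue_on \<Omega>. LINT x'|lebesgue_on \<Omega>.
        A x x' * (jacobian u (at x) \<bullet> jacobian v (at x')))"

text \<open>
  \<open>J\<close> exhibits the Hilbert space \<open>'h\<close> as the completion of the space \<open>D\<close> of functions
  with inner product \<open>ip\<close>: it is a linear isometry of \<open>D\<close> onto a dense subspace. This
  determines the pair \<open>('h, J)\<close> up to a unique isometric isomorphism.
\<close>

definition hilbert_completion ::
    "('a \<Rightarrow> 'b::real_vector) set \<Rightarrow> (('a \<Rightarrow> 'b) \<Rightarrow> ('a \<Rightarrow> 'b) \<Rightarrow> real) \<Rightarrow>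
     (('a \<Rightarrow> 'b) \<Rightarrow> 'h::{real_inner,complete_space}) \<Rightarrow> bool" where
  "hilbert_completion D ip J \<longleftrightarrow>
     (\<forall>u\<in>D. \<forall>v\<in>D. J (\<lambda>x. u x + v x) = J u + J v) \<and>
     (\<forall>c. \<forall>u\<in>D. J (\<lambda>x. c *\<^sub>R u x) = c *\<^sub>R J u) \<and>
     (\<forall>u\<in>D. \<forall>v\<in>D. J u \<bullet> J v = ip u v) \<and>
     closure (J ` D) = UNIV"

definition L2_compactly_embedded ::
    "'a::euclidean_space set \<Rightarrow> (('a \<Rightarrow> 'b::euclidean_space) \<Rightarrow> 'h::real_normed_vector) \<Rightarrow> bool" where
  "L2_compactly_embedded \<Omega> J \<longleftrightarrow>
     (\<exists>T. compact_operator_on_L2 \<Omega> T \<and> (\<forall>\<phi>\<in>test_functions \<Omega>. T \<phi> = J \<phi>))"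

end

theory Submission
  imports Defs
begin

text \<open>
  The energy norm of a test function \<open>u\<close> can be computed without derivatives of \<open>u\<close>. Put
  \<open>w(d) = \<integral> u(y + d) \<bullet> u(y) dy\<close>, the correlation of \<open>u\<close> with itself; it is a test function on
  \<open>\<Omega> - \<Omega>\<close>. Substituting \<open>d = x - x'\<close> in the double integral turns \<open>(u, u)\<^sub>A\<close> into the integral of
  \<open>A'(|d|)\<close> against the correlation of \<open>\<nabla>u\<close> with itself, and this correlation is \<open>- \<Delta>w\<close>, because
  differentiating \<open>w\<close> once moves a derivative to the first factor and, after the change of variables
  \<open>y \<mapsto> y - d\<close>, differentiating again moves one to the second factor with a minus sign. The definition
  of the weak Laplacian then replaces \<open>\<integral> A'(|d|) \<Delta>w(d) dd\<close> by \<open>\<integral> L(d) w(d) dd\<close>. Undoing the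
  substitution gives
  \<open>\<parallel>u\<parallel>\<^sub>A\<^sup>2 = - \<integral>\<integral> L(x - x') u(x) \<bullet> u(x') dx dx'\<close> (\<open>kernel_inner_eq_laplacian_form\<close>).

  So the energy is a quadratic form with a square-integrable kernel \<open>k\<close> on \<open>\<Omega> \<times> \<Omega>\<close>, that is, it is
  given by a Hilbert-Schmidt operator. Boundedness is the Cauchy-Schwarz inequality on \<open>\<Omega> \<times> \<Omega>\<close>, used
  here in the form \<open>2|ab| \<le> t a\<^sup>2 + b\<^sup>2 / t\<close> (\<open>kernel_form_bound\<close>). For compactness, \<open>k\<close> is within
  any \<open>\<epsilon>\<close> in \<open>L\<^sup>2\<close> of a kernel \<open>\<Sum>\<^sub>i a\<^sub>i(x) b\<^sub>i(x')\<close>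
  (\<open>L2_kernel_finite_rank_approximation\<close>). Hence, on a ball of \<open>L\<^sup>2\<close>, the energy of \<open>u\<close> is small as
  soon as the finitely many vectors \<open>\<integral> b\<^sub>i u\<close> are small (\<open>kernel_form_small\<close>). These vectors range
  over a bounded subset of a finite-dimensional space, so the image of the ball in the energy space is
  totally bounded (\<open>J_totally_bounded\<close>). Because test functions are dense in \<open>L\<^sup>2\<close>
  (\<open>test_functions_dense_L2\<close>), the embedding extends to all of \<open>L\<^sup>2\<close> by limits, and the extension
  maps bounded sets into closures of totally bounded sets.

  Density of the test functions needs smooth cutoffs. They are obtained as correlations of a smooth
  bump, built from \<open>exp (- 1 / t)\<close>, with a continuous cutoff.
\<close>

section \<open>Calculus of continuously differentiable functions\<close>

lemma Ck_imp_continuous: "Ck k f \<Longrightarrow> continuous_on UNIV f"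
  by (cases k) (auto intro!: differentiable_imp_continuous_on simp: differentiable_on_def)

text \<open>
  This replaces the derivative chosen by \<open>frechet_derivative\<close> with an explicit one, which is how
  all closure properties below are proved.
\<close>

lemma Ck_SucI:
  assumes "\<And>x. (f has_derivative f' x) (at x)" "\<And>v. Ck k (\<lambda>x. f' x v)"
  shows "Ck (Suc k) f"
proof -
  have "frechet_derivative f (at x) = f' x" for x
    using frechet_derivative_at[OF assms(1)] by simp
  then show ?thesis
    using assms by (auto simp: differentiable_def)
qed

lemma Ck_Suc_has_derivative:
  "Ck (Suc k) f \<Longrightarrow> (f has_derivative frechet_derivative f (at x)) (at x)"
  using frechet_derivative_works by auto

lemma Ck_SucD: "Ck (Suc k) f \<Longrightarrow> Ck k f"
proof (induction k arbitrary: f)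
  case 0
  then show ?case
    using Ck_imp_continuous by (metis Ck.simps(1))
qed auto

lemma Ck_const: "Ck k (\<lambda>x. c)"
proof (induction k arbitrary: c)
  case (Suc k)
  show ?case
    by (rule Ck_SucI[where f' = "\<lambda>_ _. 0"]) (auto intro: Suc)
qed auto

lemma Ck_bounded_linear:
  assumes "bounded_linear B" "Ck k f"
  shows "Ck k (\<lambda>x. B (f x))"
  using assms(2)
proof (induction k arbitrary: f)
  case 0
  then show ?case
    using assms(1) by (auto intro: bounded_linear.continuous_on)
next
  case (Suc k)
  show ?case
    using bounded_linear.has_derivative[OF assms(1) Ck_Suc_has_derivative[OF Suc.prems]] Suc
    by (intro Ck_SucI) auto
qed

lemma Ck_id: "Ck k (\<lambda>x. x)"
  by (cases k) (auto intro!: Ck_SucI[where f' = "\<lambda>_ v. v"] Ck_const)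

lemma Ck_add:
  assumes "Ck k f" "Ck k g"
  shows "Ck k (\<lambda>x. f x + g x)"
  using assms
proof (induction k arbitrary: f g)
  case 0
  then show ?case by (auto intro: continuous_on_add)
next
  case (Suc k)
  show ?case
    using has_derivative_add[OF Ck_Suc_has_derivative[OF Suc.prems(1)] Ck_Suc_has_derivative[OF Suc.prems(2)]]
      Suc
    by (intro Ck_SucI) auto
qed

lemma Ck_mult:
  fixes f g :: "'a::euclidean_space \<Rightarrow> real"
  assumes "Ck k f" "Ck k g"
  shows "Ck k (\<lambda>x. f x * g x)"
  using assms
proof (induction k arbitrary: f g)
  case 0
  then show ?case by (auto intro: continuous_on_mult)
next
  case (Suc k)
  show ?case
  proof (rule Ck_SucI)
    show "((\<lambda>x. f x * g x) has_derivative
        (\<lambda>v. f x * frechet_derivative g (at x) v + frechet_derivative f (at x) v * g x)) (at x)" for x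
      by (rule has_derivative_mult[OF Ck_Suc_has_derivative[OF Suc.prems(1)] Ck_Suc_has_derivative[OF Suc.prems(2)]])
  qed (use Suc Ck_SucD[OF Suc.prems(1)] Ck_SucD[OF Suc.prems(2)] in \<open>auto intro!: Ck_add\<close>)
qed

section \<open>A smooth bump function\<close>

text \<open>
  For \<open>m = 0\<close> this is the standard function \<open>exp (- 1 / t)\<close>, flat at \<open>0\<close>. The powers of \<open>1 / t\<close> are
  included so that the family is closed under differentiation up to linear combinations; smoothness
  then follows by induction for all \<open>m\<close> at once.
\<close>

definition flat_exp :: "nat \<Rightarrow> real \<Rightarrow> real" where
  "flat_exp m t = (if t > 0 then inverse t ^ m * exp (- inverse t) else 0)"

lemma flat_exp_tendsto_0: "(flat_exp m \<longlongrightarrow> 0) (at_right 0)"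
proof -
  have "((\<lambda>t::real. t ^ m / exp t) \<longlongrightarrow> 0) at_top"
    by (rule tendsto_power_div_exp_0)
  then have "((\<lambda>t::real. inverse t ^ m / exp (inverse t)) \<longlongrightarrow> 0) (at_right 0)"
    by (rule filterlim_compose[OF _ filterlim_inverse_at_top_right])
  moreover have "eventually (\<lambda>t. inverse t ^ m / exp (inverse t) = flat_exp m t) (at_right (0::real))"
    unfolding eventually_at_filter by (auto simp: flat_exp_def exp_minus divide_inverse)
  ultimately show ?thesis
    by (rule Lim_transform_eventually)
qed

text \<open>
  At \<open>t = 0\<close> the difference quotient from the right is \<open>flat_exp (m + 1)\<close>, which vanishes in the
  limit because exponentials dominate powers.
\<close>

lemma flat_exp_has_derivative:
  "(flat_exp m has_real_derivative flat_exp (m + 2) t - m * flat_exp (m + 1) t) (at t)"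
proof -
  consider "t > 0" | "t < 0" | "t = 0" by linarith
  then show ?thesis
  proof cases
    case 1
    have "real m * inverse t ^ (m - Suc 0) * (inverse t * inverse t) = real m * inverse t ^ (m + 1)"
      by (cases m) auto
    with 1 have "((\<lambda>t. inverse t ^ m * exp (- inverse t)) has_real_derivative
        flat_exp (m + 2) t - m * flat_exp (m + 1) t) (at t)"
      by (auto intro!: derivative_eq_intros simp: flat_exp_def algebra_simps power2_eq_square)
    then show ?thesis
      by (rule has_field_derivative_transform_within_open[where S = "{0<..}"]) (use 1 in \<open>auto simp: flat_exp_def\<close>)
  next
    case 2
    have "((\<lambda>t. 0) has_real_derivative flat_exp (m + 2) t - m * flat_exp (m + 1) t) (at t)"
      using 2 by (simp add: flat_exp_def)
    then show ?thesis
      by (rule has_field_derivative_transform_within_open[where S = "{..<0}"]) (use 2 in \<open>auto simp: flat_exp_def\<close>)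
  next
    case 3
    have "eventually (\<lambda>h. flat_exp (m + 1) h = (flat_exp m (0 + h) - flat_exp m 0) / h) (at_right 0)"
      unfolding eventually_at_filter by (auto simp: flat_exp_def field_simps)
    with flat_exp_tendsto_0 have R: "((\<lambda>h. (flat_exp m (0 + h) - flat_exp m 0) / h) \<longlongrightarrow> 0) (at_right 0)"
      by (rule Lim_transform_eventually)
    have "eventually (\<lambda>h. 0 = (flat_exp m (0 + h) - flat_exp m 0) / h) (at_left 0)"
      unfolding eventually_at_filter by (auto simp: flat_exp_def)
    with tendsto_const have "((\<lambda>h. (flat_exp m (0 + h) - flat_exp m 0) / h) \<longlongrightarrow> 0) (at_left 0)"
      by (rule Lim_transform_eventually)
    with R show ?thesis
      using 3 by (auto simp: DERIV_def flat_exp_def filterlim_at_split)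
  qed
qed

lemma Ck_flat_exp_ball: "Ck k (\<lambda>x::'a::euclidean_space. flat_exp m (c - x \<bullet> x))"
proof (induction k arbitrary: m)
  case 0
  have flat: "continuous_on UNIV (flat_exp m)"
    using flat_exp_has_derivative DERIV_isCont by (blast intro: continuous_at_imp_continuous_on)
  have "continuous_on UNIV (\<lambda>x::'a. c - x \<bullet> x)"
    by (intro continuous_intros)
  from continuous_on_compose2[OF flat this] show ?case by simp
next
  case (Suc k)
  let ?g = "\<lambda>x::'a. flat_exp (m + 2) (c - x \<bullet> x) + - real m * flat_exp (m + 1) (c - x \<bullet> x)"
  show ?case
  proof (rule Ck_SucI)
    fix x :: 'a
    have "((\<lambda>x. c - x \<bullet> x) has_derivative (\<lambda>v. - 2 * (x \<bullet> v))) (at x)"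
      by (auto intro!: derivative_eq_intros simp: inner_commute)
    from has_derivative_compose[OF this flat_exp_has_derivative[unfolded has_field_derivative_def]]
    show "((\<lambda>x. flat_exp m (c - x \<bullet> x)) has_derivative (\<lambda>v. ?g x * (- 2 * (x \<bullet> v)))) (at x)"
      by simp
  next
    fix v :: 'a
    have "bounded_linear (\<lambda>x. - 2 * (x \<bullet> v))"
      by (intro bounded_linear_const_mult bounded_linear_inner_left)
    then have "Ck k (\<lambda>x. - 2 * (x \<bullet> v))"
      using Ck_bounded_linear[OF _ Ck_id] by blast
    moreover have "Ck k ?g"
      by (intro Ck_add Ck_mult Ck_const Suc)
    ultimately show "Ck k (\<lambda>x. ?g x * (- 2 * (x \<bullet> v)))"
      using Ck_mult by blast
  qed
qed

lemma continuous_bounded_support_integrable: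
  fixes f :: "'a::euclidean_space \<Rightarrow> 'b::euclidean_space"
  assumes "continuous_on UNIV f" "compact K" "\<And>x. x \<notin> K \<Longrightarrow> f x = 0"
  shows "integrable lborel f"
proof -
  have "set_integrable lborel K f"
    using assms borel_integrable_compact continuous_on_subset
    unfolding set_integrable_def by (metis indicator_scaleR_eq_if subset_UNIV)
  moreover have "(\<lambda>x. indicator K x *\<^sub>R f x) = f"
    using assms(3) by (auto simp: indicator_def)
  ultimately show ?thesis
    by (simp add: set_integrable_def)
qed

lemma exists_bump:
  fixes r :: real
  assumes "r > 0"
  obtains \<eta> :: "'a::euclidean_space \<Rightarrow> real"
    where "\<And>k. Ck k \<eta>" "\<And>x. \<eta> x \<ge> 0" "\<And>x. norm x \<ge> r \<Longrightarrow> \<eta> x = 0"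
      "integrable lborel \<eta>" "(LINT x|lborel. \<eta> x) = 1"
proof -
  define f :: "'a \<Rightarrow> real" where "f x = flat_exp 0 (r\<^sup>2 - x \<bullet> x)" for x
  have f_Ck: "Ck k f" for k
    unfolding f_def by (rule Ck_flat_exp_ball)
  have f_nonneg: "f x \<ge> 0" for x
    by (simp add: f_def flat_exp_def)
  have f_pos_iff: "f x \<noteq> 0 \<longleftrightarrow> norm x < r" for x
  proof -
    have "x \<bullet> x < r\<^sup>2 \<longleftrightarrow> norm x < r"
      using assms power_mono_iff[of r "norm x" 2] by (simp add: power2_norm_eq_inner flip: not_le)
    then show ?thesis by (simp add: f_def flat_exp_def)
  qed
  have f_int: "integrable lborel f"
  proof (rule continuous_bounded_support_integrable)
    show "continuous_on UNIV f"
      by (rule Ck_imp_continuous[OF f_Ck])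
    show "f x = 0" if "x \<notin> cball 0 r" for x
      using f_pos_iff[of x] that by auto
  qed auto
  define c where "c = (LINT x|lborel. f x)"
  have "c \<noteq> 0"
  proof
    assume "c = 0"
    then have "AE x in lborel. f x = 0"
      using integral_nonneg_eq_0_iff_AE[OF f_int] f_nonneg by (simp add: c_def)
    moreover have "f x = 0 \<longleftrightarrow> x \<notin> ball 0 r" for x
      using f_pos_iff[of x] by auto
    ultimately have "AE x in lborel. x \<notin> ball (0::'a) r"
      by simp
    then have "AE x in lebesgue. x \<notin> ball (0::'a) r"
      by (rule AE_completion)
    then have "negligible (ball (0::'a) r)"
      by (auto simp: completion.AE_iff_null_sets negligible_iff_null_sets ball_def dist_norm)
    then show False
      using assms open_not_negligible[of "ball (0::'a) r"] by auto
  qed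
  moreover have "c \<ge> 0"
    unfolding c_def by (rule integral_nonneg_AE) (use f_nonneg in auto)
  ultimately have "c > 0" by simp
  show ?thesis
  proof (rule that[of "\<lambda>x. inverse c * f x"])
    show "Ck k (\<lambda>x. inverse c * f x)" for k
      by (intro Ck_mult Ck_const f_Ck)
    show "inverse c * f x = 0" if "norm x \<ge> r" for x
      using f_pos_iff that by (metis mult_zero_right not_less)
  qed (use \<open>c > 0\<close> f_nonneg f_int c_def in auto)
qed

section \<open>Test functions and their correlations\<close>

lemma test_functionsI:
  assumes "\<And>k. Ck k f" "compact K" "K \<subseteq> \<Omega>" "\<And>x. x \<notin> K \<Longrightarrow> f x = 0"
  shows "f \<in> test_functions \<Omega>"
proof -
  have "closure {x. f x \<noteq> 0} \<subseteq> K"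
    using assms(2,4) by (intro closure_minimal) (auto intro: compact_imp_closed)
  moreover from this assms(2) have "compact (closure {x. f x \<noteq> 0})"
    by (meson closed_closure compact_closure compact_imp_bounded bounded_subset bounded_closure closure_subset)
  ultimately show ?thesis
    using assms(1,3) by (auto simp: test_functions_def)
qed

lemma test_functionsE:
  assumes "f \<in> test_functions \<Omega>"
  obtains K where "compact K" "K \<subseteq> \<Omega>" "\<And>x. x \<notin> K \<Longrightarrow> f x = 0"
proof
  show "f x = 0" if "x \<notin> closure {x. f x \<noteq> 0}" for x
    using that closure_subset[of "{x. f x \<noteq> 0}"] by blast
qed (use assms in \<open>auto simp: test_functions_def\<close>)

lemma test_functions_Ck: "f \<in> test_functions \<Omega> \<Longrightarrow> Ck k f"
  by (simp add: test_functions_def)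

lemma test_functions_continuous: "f \<in> test_functions \<Omega> \<Longrightarrow> continuous_on UNIV f"
  using Ck_imp_continuous[of 0 f] by (simp add: test_functions_def)

lemma test_functions_outside: "f \<in> test_functions \<Omega> \<Longrightarrow> x \<notin> \<Omega> \<Longrightarrow> f x = 0"
  by (erule test_functionsE) auto

lemma test_functions_add:
  assumes "f \<in> test_functions \<Omega>" "g \<in> test_functions \<Omega>"
  shows "(\<lambda>x. f x + g x) \<in> test_functions \<Omega>"
proof -
  obtain K K' where "compact K" "K \<subseteq> \<Omega>" "\<And>x. x \<notin> K \<Longrightarrow> f x = 0"
    "compact K'" "K' \<subseteq> \<Omega>" "\<And>x. x \<notin> K' \<Longrightarrow> g x = 0"
    using test_functionsE[OF assms(1)] test_functionsE[OF assms(2)] by metis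
  then show ?thesis
    by (intro test_functionsI[where K = "K \<union> K'"])
      (auto intro: Ck_add test_functions_Ck[OF assms(1)] test_functions_Ck[OF assms(2)])
qed

lemma test_functions_bounded_linear:
  assumes "bounded_linear B" "f \<in> test_functions \<Omega>"
  shows "(\<lambda>x. B (f x)) \<in> test_functions \<Omega>"
proof -
  obtain K where K: "compact K" "K \<subseteq> \<Omega>" "\<And>x. x \<notin> K \<Longrightarrow> f x = 0"
    using test_functionsE[OF assms(2)] by metis
  then show ?thesis
    using Ck_bounded_linear[OF assms(1) test_functions_Ck[OF assms(2)]] linear_0[OF bounded_linear.linear[OF assms(1)]]
    by (intro test_functionsI[OF _ K(1,2)]) auto
qed

lemma test_functions_zero: "(\<lambda>x. 0) \<in> test_functions \<Omega>"
  by (rule test_functionsI[where K = "{}"]) (auto intro: Ck_const)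

lemma frechet_derivative_outside_support:
  assumes "closed K" "\<And>x. x \<notin> K \<Longrightarrow> f x = 0" "x \<notin> K"
  shows "frechet_derivative f (at x) = (\<lambda>v. 0)"
proof -
  have "(f has_derivative (\<lambda>v. 0)) (at x)"
    by (rule has_derivative_transform_within_open[where f = "\<lambda>x. 0" and s = "- K"])
      (use assms in auto)
  then show ?thesis
    using frechet_derivative_at by metis
qed

lemma test_functions_deriv:
  assumes "f \<in> test_functions \<Omega>"
  shows "(\<lambda>x. frechet_derivative f (at x) v) \<in> test_functions \<Omega>"
proof -
  obtain K where K: "compact K" "K \<subseteq> \<Omega>" "\<And>x. x \<notin> K \<Longrightarrow> f x = 0"
    using test_functionsE[OF assms] by metis
  have "Ck k (\<lambda>x. frechet_derivative f (at x) v)" for k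
    using test_functions_Ck[OF assms, of "Suc k"] by simp
  moreover have "frechet_derivative f (at x) v = 0" if "x \<notin> K" for x
    using frechet_derivative_outside_support[OF compact_imp_closed[OF K(1)] K(3) that] by simp
  ultimately show ?thesis
    using test_functionsI[OF _ K(1,2)] by blast
qed

lemma test_functions_has_derivative:
  "f \<in> test_functions \<Omega> \<Longrightarrow> (f has_derivative frechet_derivative f (at x)) (at x)"
  using Ck_Suc_has_derivative[of 0 f x] test_functions_Ck[of f \<Omega> "Suc 0"] by simp

text \<open>
  Up to the reflection \<open>y \<mapsto> - y\<close> of one argument this is a convolution. Its derivatives fall on
  \<open>\<phi>\<close> alone, so \<open>\<psi>\<close> need only be continuous with compact support. That makes the same construction
  serve both for the energy identity and for mollifying cutoff functions.
\<close>

definition correlation ::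
    "('a::euclidean_space \<Rightarrow> 'b::euclidean_space) \<Rightarrow> ('a \<Rightarrow> 'b) \<Rightarrow> 'a \<Rightarrow> real" where
  "correlation \<phi> \<psi> d = (LINT y|lborel. \<phi> (y + d) \<bullet> \<psi> y)"

lemma correlation_eq_integral_cbox:
  assumes "continuous_on UNIV \<phi>" "continuous_on UNIV \<psi>" "\<And>x. x \<notin> cbox a b \<Longrightarrow> \<psi> x = 0"
  shows "correlation \<phi> \<psi> d = integral (cbox a b) (\<lambda>y. \<phi> (y + d) \<bullet> \<psi> y)"
proof -
  have "continuous_on UNIV (\<lambda>y. \<phi> (y + d) \<bullet> \<psi> y)"
    by (intro continuous_intros assms continuous_on_compose2[OF assms(1)]) auto
  then have "integrable lborel (\<lambda>y. \<phi> (y + d) \<bullet> \<psi> y)"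
    using assms(3) by (intro continuous_bounded_support_integrable[where K = "cbox a b"]) auto
  then have "correlation \<phi> \<psi> d = integral UNIV (\<lambda>y. \<phi> (y + d) \<bullet> \<psi> y)"
    by (simp add: correlation_def integral_lborel)
  also have "(\<lambda>y. \<phi> (y + d) \<bullet> \<psi> y) = (\<lambda>y. if y \<in> cbox a b then \<phi> (y + d) \<bullet> \<psi> y else 0)"
    using assms(3) by auto
  finally show ?thesis
    by (simp add: integral_restrict_UNIV)
qed

lemma correlation_outside:
  assumes "\<And>x. x \<notin> K \<Longrightarrow> \<phi> x = 0" "\<And>x. x \<notin> K' \<Longrightarrow> \<psi> x = 0"
    and d: "d \<notin> {x - y |x y. x \<in> K \<and> y \<in> K'}"
  shows "correlation \<phi> \<psi> d = 0"
proof -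
  have "\<phi> (y + d) \<bullet> \<psi> y = 0" for y
  proof (rule ccontr)
    assume "\<not> ?thesis"
    then have "y + d \<in> K" "y \<in> K'"
      using assms(1,2) by force+
    moreover have "d = (y + d) - y" by simp
    ultimately show False
      using d by blast
  qed
  then show ?thesis
    unfolding correlation_def by (simp only: integral_zero)
qed

lemma compact_subset_cbox:
  assumes "compact (K::'a::euclidean_space set)"
  obtains a b where "K \<subseteq> cbox a b"
  using bounded_subset_cbox_symmetric[OF compact_imp_bounded[OF assms]] by metis

text \<open>
  Differentiation under the integral sign: the compact support of \<open>\<psi>\<close> confines the integration to
  one box for all \<open>d\<close>.
\<close>

lemma correlation_has_derivative:
  assumes \<phi>: "Ck (Suc 0) \<phi>" and \<psi>: "continuous_on UNIV \<psi>" and K: "compact K" "\<And>x. x \<notin> K \<Longrightarrow> \<psi> x = 0"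
  shows "(correlation \<phi> \<psi> has_derivative
    (\<lambda>v. correlation (\<lambda>x. frechet_derivative \<phi> (at x) v) \<psi> d)) (at d)"
proof -
  obtain a b where ab: "K \<subseteq> cbox a b"
    using compact_subset_cbox K by blast
  then have \<psi>0: "\<And>x. x \<notin> cbox a b \<Longrightarrow> \<psi> x = 0"
    using K by auto
  have \<phi>_cont: "continuous_on UNIV \<phi>"
    by (rule Ck_imp_continuous[OF \<phi>])
  have d\<phi>_cont: "continuous_on UNIV (\<lambda>x. frechet_derivative \<phi> (at x) v)" for v
    using \<phi> by simp
  define D where "D = (\<lambda>x t. Blinfun (\<lambda>v. frechet_derivative \<phi> (at (t + x)) v \<bullet> \<psi> t))"
  have D_apply: "blinfun_apply (D x t) v = frechet_derivative \<phi> (at (t + x)) v \<bullet> \<psi> t" for x t v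
  proof -
    have "bounded_linear (frechet_derivative \<phi> (at (t + x)))"
      using Ck_Suc_has_derivative[OF \<phi>] has_derivative_bounded_linear by blast
    then have "bounded_linear (\<lambda>v. frechet_derivative \<phi> (at (t + x)) v \<bullet> \<psi> t)"
      by (rule bounded_linear_inner_left_comp)
    then show ?thesis
      by (simp add: D_def bounded_linear_Blinfun_apply)
  qed
  have D_cont: "continuous_on (UNIV \<times> cbox a b) (\<lambda>(x, t). D x t)"
    unfolding case_prod_unfold
  proof (rule continuous_on_blinfun_componentwise)
    fix i :: 'a
    show "continuous_on (UNIV \<times> cbox a b) (\<lambda>p. blinfun_apply (D (fst p) (snd p)) i)"
      unfolding D_apply
      by (intro continuous_intros continuous_on_compose2[OF d\<phi>_cont] continuous_on_compose2[OF \<psi>]) auto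
  qed
  have "((\<lambda>x. integral (cbox a b) (\<lambda>t. \<phi> (t + x) \<bullet> \<psi> t)) has_derivative integral (cbox a b) (D d)) (at d within UNIV)"
  proof (rule leibniz_rule)
    fix x t :: 'a
    have "((\<lambda>x. t + x) has_derivative (\<lambda>v. v)) (at x)"
      by (auto intro!: derivative_eq_intros)
    from has_derivative_compose[OF this Ck_Suc_has_derivative[OF \<phi>]]
    have "((\<lambda>x. \<phi> (t + x)) has_derivative (\<lambda>v. frechet_derivative \<phi> (at (t + x)) v)) (at x)" .
    then show "((\<lambda>x. \<phi> (t + x) \<bullet> \<psi> t) has_derivative blinfun_apply (D x t)) (at x within UNIV)"
      unfolding D_apply by (auto intro!: derivative_eq_intros)
  next
    show "(\<lambda>t. \<phi> (t + x) \<bullet> \<psi> t) integrable_on cbox a b" for x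
      by (intro integrable_continuous continuous_intros continuous_on_compose2[OF \<phi>_cont]
          continuous_on_subset[OF \<psi>]) auto
  qed (use D_cont in auto)
  moreover have "blinfun_apply (integral (cbox a b) (D d))
      = (\<lambda>v. correlation (\<lambda>x. frechet_derivative \<phi> (at x) v) \<psi> d)"
  proof
    fix v
    have "continuous_on (cbox a b) (\<lambda>t. (d, t))"
      by (intro continuous_intros)
    from continuous_on_compose2[OF D_cont this] have "continuous_on (cbox a b) (D d)"
      by auto
    then have "D d integrable_on cbox a b"
      by (rule integrable_continuous)
    then show "blinfun_apply (integral (cbox a b) (D d)) v
        = correlation (\<lambda>x. frechet_derivative \<phi> (at x) v) \<psi> d"
      by (simp add: blinfun_apply_integral D_apply correlation_eq_integral_cbox[OF d\<phi>_cont \<psi> \<psi>0])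
  qed
  moreover have "correlation \<phi> \<psi> = (\<lambda>x. integral (cbox a b) (\<lambda>t. \<phi> (t + x) \<bullet> \<psi> t))"
    by (rule ext) (rule correlation_eq_integral_cbox[OF \<phi>_cont \<psi> \<psi>0])
  ultimately show ?thesis
    by (simp only:)
qed

lemma Ck_correlation:
  assumes "Ck k \<phi>" and \<psi>: "continuous_on UNIV \<psi>" and K: "compact K" "\<And>x. x \<notin> K \<Longrightarrow> \<psi> x = 0"
  shows "Ck k (correlation \<phi> \<psi>)"
proof -
  obtain a b where ab: "K \<subseteq> cbox a b"
    by (rule compact_subset_cbox[OF K(1)])
  then have \<psi>0: "\<And>x. x \<notin> cbox a b \<Longrightarrow> \<psi> x = 0"
    using K(2) by auto
  from assms(1) show ?thesis
  proof (induction k arbitrary: \<phi>)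
    case 0
    then have \<phi>_cont: "continuous_on UNIV \<phi>"
      by simp
    have "continuous_on (UNIV \<times> cbox a b) (\<lambda>p. \<phi> (snd p + fst p))"
      by (rule continuous_on_compose2[OF \<phi>_cont]) (auto intro!: continuous_intros)
    moreover have "continuous_on (UNIV \<times> cbox a b) (\<lambda>p::'a \<times> 'a. \<psi> (snd p))"
      by (rule continuous_on_compose2[OF \<psi>]) (auto intro!: continuous_intros)
    ultimately have "continuous_on (UNIV \<times> cbox a b) (\<lambda>(d, y). \<phi> (y + d) \<bullet> \<psi> y)"
      unfolding case_prod_unfold by (rule continuous_on_inner)
    then have "continuous_on UNIV (\<lambda>d. integral (cbox a b) (\<lambda>y. \<phi> (y + d) \<bullet> \<psi> y))"
      by (rule integral_continuous_on_param)
    moreover have "correlation \<phi> \<psi> = (\<lambda>x. integral (cbox a b) (\<lambda>t. \<phi> (t + x) \<bullet> \<psi> t))"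
      by (rule ext) (rule correlation_eq_integral_cbox[OF \<phi>_cont \<psi> \<psi>0])
    ultimately show ?case
      by simp
  next
    case (Suc k)
    have "Ck (Suc 0) \<phi>"
      using Suc.prems by (auto intro: Ck_imp_continuous)
    moreover have "Ck k (correlation (\<lambda>x. frechet_derivative \<phi> (at x) v) \<psi>)" for v
      using Suc.IH Suc.prems by simp
    ultimately show ?case
      by (intro Ck_SucI[where f' = "\<lambda>d v. correlation (\<lambda>x. frechet_derivative \<phi> (at x) v) \<psi> d"]
          correlation_has_derivative[OF _ \<psi> K(1)] K(2))
  qed
qed

lemma lborel_integral_shift:
  fixes f :: "'a::euclidean_space \<Rightarrow> 'b::euclidean_space"
  assumes "f \<in> borel_measurable borel"
  shows "(LINT y|lborel. f (c + y)) = (LINT y|lborel. f y)"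
  using integral_distr[of "(+) c" lborel borel f] assms by (simp add: lborel_distr_plus)

lemma correlation_flip:
  assumes "continuous_on UNIV \<phi>" "continuous_on UNIV \<psi>"
  shows "correlation \<phi> \<psi> d = correlation \<psi> \<phi> (- d)"
proof -
  have "continuous_on UNIV (\<lambda>y. \<phi> y \<bullet> \<psi> (y - d))"
    by (intro continuous_intros continuous_on_compose2[OF assms(2)] assms(1)) auto
  from lborel_integral_shift[OF borel_measurable_continuous_onI[OF this], of d]
  show ?thesis
    by (simp add: correlation_def inner_commute add.commute)
qed

lemma correlation_test_functions:
  assumes \<phi>: "\<phi> \<in> test_functions \<Omega>" and \<psi>: "\<psi> \<in> test_functions \<Omega>"
  shows "correlation \<phi> \<psi> \<in> test_functions {x - x' | x x'. x \<in> \<Omega> \<and> x' \<in> \<Omega>}"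
proof -
  obtain K where K: "compact K" "K \<subseteq> \<Omega>" "\<And>x. x \<notin> K \<Longrightarrow> \<phi> x = 0"
    using test_functionsE[OF \<phi>] by metis
  obtain K' where K': "compact K'" "K' \<subseteq> \<Omega>" "\<And>x. x \<notin> K' \<Longrightarrow> \<psi> x = 0"
    using test_functionsE[OF \<psi>] by metis
  show ?thesis
  proof (rule test_functionsI)
    show "Ck k (correlation \<phi> \<psi>)" for k
      using Ck_correlation[OF test_functions_Ck[OF \<phi>] test_functions_continuous[OF \<psi>] K'(1,3)] by blast
    show "compact {x - y |x y. x \<in> K \<and> y \<in> K'}"
      by (rule compact_differences[OF K(1) K'(1)])
    show "correlation \<phi> \<psi> d = 0" if "d \<notin> {x - y |x y. x \<in> K \<and> y \<in> K'}" for d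
      by (rule correlation_outside[OF _ _ that]) (fact K(3), fact K'(3))
  qed (use K(2) K'(2) in auto)
qed

text \<open>
  The first derivative falls on \<open>\<phi>\<close>. Flipping the correlation exchanges the two factors and negates
  the argument, so the second derivative falls on \<open>\<psi>\<close> with a minus sign. No integration by parts is
  involved.
\<close>

lemma laplacian_correlation:
  assumes \<phi>: "\<phi> \<in> test_functions \<Omega>" and \<psi>: "\<psi> \<in> test_functions \<Omega>"
  shows "laplacian (correlation \<phi> \<psi>) d =
    - (\<Sum>b\<in>Basis. correlation (\<lambda>x. frechet_derivative \<phi> (at x) b) (\<lambda>x. frechet_derivative \<psi> (at x) b) d)"
proof -
  have "partial_deriv b (partial_deriv b (correlation \<phi> \<psi>)) d =
     - correlation (\<lambda>x. frechet_derivative \<phi> (at x) b) (\<lambda>x. frechet_derivative \<psi> (at x) b) d" for b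
  proof -
    define \<phi>' where "\<phi>' = (\<lambda>x. frechet_derivative \<phi> (at x) b)"
    define \<psi>' where "\<psi>' = (\<lambda>x. frechet_derivative \<psi> (at x) b)"
    have tests: "\<phi>' \<in> test_functions \<Omega>" "\<psi>' \<in> test_functions \<Omega>"
      unfolding \<phi>'_def \<psi>'_def using \<phi> \<psi> test_functions_deriv by blast+
    note cont = test_functions_continuous[OF \<phi>] test_functions_continuous[OF \<psi>]
      test_functions_continuous[OF tests(1)] test_functions_continuous[OF tests(2)]
    obtain K where K: "compact K" "\<And>x. x \<notin> K \<Longrightarrow> \<psi> x = 0"
      using test_functionsE[OF \<psi>] by metis
    obtain K' where K': "compact K'" "\<And>x. x \<notin> K' \<Longrightarrow> \<phi>' x = 0"
      using test_functionsE[OF tests(1)] by metis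
    have "partial_deriv b (correlation \<phi> \<psi>) = correlation \<phi>' \<psi>"
      using frechet_derivative_at[OF correlation_has_derivative[OF test_functions_Ck[OF \<phi>] cont(2) K], symmetric]
      by (simp add: partial_deriv_def fun_eq_iff \<phi>'_def)
    also have "\<dots> = (\<lambda>d. correlation \<psi> \<phi>' (- d))"
      using correlation_flip[OF cont(3,2)] by auto
    finally have eq: "partial_deriv b (correlation \<phi> \<psi>) = (\<lambda>d. correlation \<psi> \<phi>' (- d))" .
    have "(uminus has_derivative uminus) (at d)"
      by (auto intro!: derivative_eq_intros)
    moreover have "(correlation \<psi> \<phi>' has_derivative
        (\<lambda>v. correlation (\<lambda>x. frechet_derivative \<psi> (at x) v) \<phi>' (- d))) (at (- d))"
      by (rule correlation_has_derivative[OF test_functions_Ck[OF \<psi>] cont(3) K'(1)]) (rule K'(2))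
    ultimately have "((\<lambda>d. correlation \<psi> \<phi>' (- d)) has_derivative
        (\<lambda>v. correlation (\<lambda>x. frechet_derivative \<psi> (at x) (- v)) \<phi>' (- d))) (at d)"
      by (rule has_derivative_compose)
    from frechet_derivative_at[OF this, symmetric]
    have "partial_deriv b (\<lambda>d. correlation \<psi> \<phi>' (- d)) d
        = correlation (\<lambda>x. frechet_derivative \<psi> (at x) (- b)) \<phi>' (- d)"
      by (simp add: partial_deriv_def)
    also have "(\<lambda>x. frechet_derivative \<psi> (at x) (- b)) = (\<lambda>x. - \<psi>' x)"
      unfolding \<psi>'_def
      using linear_neg[OF has_derivative_linear[OF test_functions_has_derivative[OF \<psi>]]] by blast
    also have "correlation (\<lambda>x. - \<psi>' x) \<phi>' (- d) = - correlation \<psi>' \<phi>' (- d)"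
      by (simp add: correlation_def)
    also have "correlation \<psi>' \<phi>' (- d) = correlation \<phi>' \<psi>' d"
      using correlation_flip[OF cont(3,4)] by simp
    finally show ?thesis
      by (simp add: eq \<phi>'_def \<psi>'_def)
  qed
  then show ?thesis
    by (simp add: laplacian_def sum_negf)
qed

section \<open>Density of test functions in the space of square-integrable functions\<close>

text \<open>
  A continuous cutoff that is constant on a \<open>\<delta>\<close>-neighbourhood of \<open>K\<close> and vanishes outside the
  \<open>2\<delta>\<close>-neighbourhood is mollified at scale \<open>\<delta>\<close>. It keeps the value \<open>1\<close> on \<open>K\<close>, and the support grows
  to at most the \<open>3\<delta>\<close>-neighbourhood.
\<close>

lemma smooth_urysohn:
  fixes K V :: "'a::euclidean_space set"
  assumes "compact K" "open V" "K \<subseteq> V"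
  obtains u :: "'a \<Rightarrow> real"
    where "u \<in> test_functions V" "\<And>x. x \<in> K \<Longrightarrow> u x = 1" "\<And>x. 0 \<le> u x" "\<And>x. u x \<le> 1"
proof (cases "K = {}")
  case True
  then show ?thesis
    using that[OF test_functions_zero] by auto
next
  case False
  then obtain \<epsilon> where \<epsilon>: "\<epsilon> > 0" "{x. infdist x K \<le> \<epsilon>} \<subseteq> V"
    using compact_in_open_separated assms by metis
  define \<delta> where "\<delta> = \<epsilon> / 3"
  have \<delta>: "\<delta> > 0" using \<epsilon> by (simp add: \<delta>_def)
  define \<psi> where "\<psi> y = max 0 (min 1 (2 - infdist (- y) K / \<delta>))" for y
  have \<psi>_cont: "continuous_on UNIV \<psi>"
    unfolding \<psi>_def using \<delta> by (intro continuous_intros) auto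
  have \<psi>_bounds: "0 \<le> \<psi> y" "\<psi> y \<le> 1" for y
    by (auto simp: \<psi>_def)
  have \<psi>_1: "\<psi> y = 1" if "infdist (- y) K \<le> \<delta>" for y
    using that \<delta> by (simp add: \<psi>_def min_def max_def field_simps)
  have \<psi>_0: "infdist (- y) K \<le> 2 * \<delta>" if "\<psi> y \<noteq> 0" for y
    using that \<delta> by (rule_tac ccontr) (simp add: \<psi>_def min_def max_def field_simps split: if_splits)
  define K' where "K' = uminus ` {x. infdist x K \<le> 2 * \<delta>}"
  have K': "compact K'" "\<And>y. y \<notin> K' \<Longrightarrow> \<psi> y = 0"
  proof -
    show "compact K'"
      unfolding K'_def using compact_infdist_le[OF False assms(1), of "2 * \<delta>"] \<delta>
      by (intro compact_continuous_image continuous_intros) auto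
    show "\<psi> y = 0" if "y \<notin> K'" for y
      using \<psi>_0[of y] that by (force simp: K'_def image_iff)
  qed
  obtain \<eta> :: "'a \<Rightarrow> real" where \<eta>: "\<And>k. Ck k \<eta>" "\<And>x. \<eta> x \<ge> 0" "\<And>x. norm x \<ge> \<delta> \<Longrightarrow> \<eta> x = 0"
    "(LINT x|lborel. \<eta> x) = 1"
    using exists_bump[OF \<delta>] by metis
  have \<eta>_cont: "continuous_on UNIV \<eta>"
    by (rule Ck_imp_continuous[OF \<eta>(1)])
  have \<eta>_shift_cont: "continuous_on UNIV (\<lambda>y. \<eta> (y + d))" for d
    by (rule continuous_on_compose2[OF \<eta>_cont]) (auto intro!: continuous_intros)
  have \<eta>_0: "\<eta> (y + d) = 0" if "y \<notin> cball (- d) \<delta>" for y d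
    using that by (intro \<eta>(3)) (auto simp: dist_norm norm_minus_commute)
  have \<eta>_int: "integrable lborel (\<lambda>y. \<eta> (y + d))" for d
    by (rule continuous_bounded_support_integrable[OF \<eta>_shift_cont compact_cball]) (rule \<eta>_0)
  have \<eta>_1: "(LINT y|lborel. \<eta> (y + d)) = 1" for d
    using lborel_integral_shift[OF borel_measurable_continuous_onI[OF \<eta>_cont], of d] \<eta>(4)
    by (simp add: add.commute)
  have \<eta>\<psi>_int: "integrable lborel (\<lambda>y. \<eta> (y + d) \<bullet> \<psi> y)" for d
    by (rule continuous_bounded_support_integrable[OF continuous_on_inner[OF \<eta>_shift_cont \<psi>_cont],
          where K = "cball (- d) \<delta>"]) (auto simp: \<eta>_0 simp del: mem_cball)
  show ?thesis
  proof (rule that[of "correlation \<eta> \<psi>"])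
    show "correlation \<eta> \<psi> \<in> test_functions V"
    proof (rule test_functionsI)
      show "Ck k (correlation \<eta> \<psi>)" for k
        by (rule Ck_correlation[OF \<eta>(1) \<psi>_cont K'(1)]) (rule K'(2))
      show "compact {x. infdist x K \<le> \<epsilon>}"
        by (rule compact_infdist_le[OF False assms(1) \<epsilon>(1)])
      show "{x. infdist x K \<le> \<epsilon>} \<subseteq> V"
        by (rule \<epsilon>(2))
      show "correlation \<eta> \<psi> d = 0" if "d \<notin> {x. infdist x K \<le> \<epsilon>}" for d
      proof -
        have "\<eta> (y + d) \<bullet> \<psi> y = 0" for y
        proof (rule ccontr)
          assume "\<eta> (y + d) \<bullet> \<psi> y \<noteq> 0"
          then have "norm (y + d) < \<delta>" "infdist (- y) K \<le> 2 * \<delta>"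
            using \<eta>(3)[of "y + d"] \<psi>_0 by force+
          moreover have "infdist d K \<le> infdist (- y) K + dist d (- y)"
            by (rule infdist_triangle)
          ultimately show False
            using that by (simp add: dist_norm \<delta>_def add.commute)
        qed
        then show ?thesis
          unfolding correlation_def by (simp only: integral_zero)
      qed
    qed
  next
    fix d
    have "0 \<le> (LINT y|lborel. \<eta> (y + d) \<bullet> \<psi> y)"
      using \<eta>(2) \<psi>_bounds by (intro integral_nonneg_AE) auto
    then show "0 \<le> correlation \<eta> \<psi> d"
      by (simp add: correlation_def)
    have "(LINT y|lborel. \<eta> (y + d) \<bullet> \<psi> y) \<le> (LINT y|lborel. \<eta> (y + d))"
      using \<eta>(2) \<psi>_bounds by (intro integral_mono \<eta>_int \<eta>\<psi>_int) (auto intro: mult_left_le)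
    then show "correlation \<eta> \<psi> d \<le> 1"
      by (simp add: correlation_def \<eta>_1)
  next
    fix d assume "d \<in> K"
    have "\<eta> (y + d) \<bullet> \<psi> y = \<eta> (y + d)" for y
    proof (cases "norm (y + d) < \<delta>")
      case True
      then have "infdist (- y) K \<le> \<delta>"
        using infdist_le[OF \<open>d \<in> K\<close>, of "- y"] by (simp add: dist_norm norm_minus_commute add.commute)
      then show ?thesis by (simp add: \<psi>_1)
    qed (use \<eta>(3) in auto)
    then show "correlation \<eta> \<psi> d = 1"
      unfolding correlation_def by (simp only: \<eta>_1)
  qed
qed

text \<open>
  Squared norms obey \<open>\<parallel>f + g\<parallel>\<^sup>2 \<le> 2\<parallel>f\<parallel>\<^sup>2 + 2\<parallel>g\<parallel>\<^sup>2\<close>, a pointwise estimate that does duty for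
  the triangle inequality below.
\<close>

definition sq_norm :: "'a::euclidean_space set \<Rightarrow> ('a \<Rightarrow> 'b::euclidean_space) \<Rightarrow> real" where
  "sq_norm \<Omega> f = (LINT x|lebesgue_on \<Omega>. (norm (f x))\<^sup>2)"

lemma sq_norm_nonneg: "sq_norm \<Omega> f \<ge> 0"
  by (simp add: sq_norm_def)

lemma norm_add_sq_le: "(norm (a + b))\<^sup>2 \<le> 2 * (norm a)\<^sup>2 + 2 * (norm (b::'b::real_normed_vector))\<^sup>2"
proof -
  have "(norm (a + b))\<^sup>2 \<le> (norm a + norm b)\<^sup>2"
    by (simp add: norm_triangle_ineq power_mono)
  also have "\<dots> \<le> 2 * (norm a)\<^sup>2 + 2 * (norm b)\<^sup>2"
    using sum_squares_bound[of "norm a" "norm b"] by (simp add: power2_sum)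
  finally show ?thesis .
qed

lemma L2_dominated:
  assumes "g \<in> L2 \<Omega>" "f \<in> borel_measurable (lebesgue_on \<Omega>)"
    "\<And>x. x \<in> \<Omega> \<Longrightarrow> norm (f x) \<le> c * norm (g x)"
  shows "f \<in> L2 \<Omega>"
proof -
  have "integrable (lebesgue_on \<Omega>) (\<lambda>x. c\<^sup>2 * (norm (g x))\<^sup>2)"
    using assms(1) by (simp add: L2_def)
  moreover have "(norm (f x))\<^sup>2 \<le> c\<^sup>2 * (norm (g x))\<^sup>2" if "x \<in> \<Omega>" for x
    using power_mono[OF assms(3)[OF that], of 2] by (simp add: power_mult_distrib)
  ultimately have "integrable (lebesgue_on \<Omega>) (\<lambda>x. (norm (f x))\<^sup>2)"
    using assms(2) by (elim Bochner_Integration.integrable_bound) (auto intro!: AE_I2)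
  then show ?thesis
    using assms(2) by (simp add: L2_def)
qed

lemma L2_add:
  assumes "f \<in> L2 \<Omega>" "g \<in> L2 \<Omega>"
  shows "(\<lambda>x. f x + g x) \<in> L2 \<Omega>" "sq_norm \<Omega> (\<lambda>x. f x + g x) \<le> 2 * sq_norm \<Omega> f + 2 * sq_norm \<Omega> g"
proof -
  have *: "integrable (lebesgue_on \<Omega>) (\<lambda>x. 2 * (norm (f x))\<^sup>2 + 2 * (norm (g x))\<^sup>2)"
    using assms by (simp add: L2_def)
  have m: "(\<lambda>x. f x + g x) \<in> borel_measurable (lebesgue_on \<Omega>)"
    using assms by (intro borel_measurable_add) (auto simp: L2_def)
  have **: "integrable (lebesgue_on \<Omega>) (\<lambda>x. (norm (f x + g x))\<^sup>2)"
    using m by (intro Bochner_Integration.integrable_bound[OF *]) (auto simp: norm_add_sq_le)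
  with m show "(\<lambda>x. f x + g x) \<in> L2 \<Omega>"
    by (simp add: L2_def)
  have "sq_norm \<Omega> (\<lambda>x. f x + g x) \<le> (LINT x|lebesgue_on \<Omega>. 2 * (norm (f x))\<^sup>2 + 2 * (norm (g x))\<^sup>2)"
    unfolding sq_norm_def by (intro integral_mono * **) (rule norm_add_sq_le)
  also have "\<dots> = 2 * sq_norm \<Omega> f + 2 * sq_norm \<Omega> g"
    using assms by (simp add: L2_def sq_norm_def)
  finally show "sq_norm \<Omega> (\<lambda>x. f x + g x) \<le> 2 * sq_norm \<Omega> f + 2 * sq_norm \<Omega> g" .
qed

lemma L2_scaleR:
  assumes "f \<in> L2 \<Omega>"
  shows "(\<lambda>x. c *\<^sub>R f x) \<in> L2 \<Omega>" "sq_norm \<Omega> (\<lambda>x. c *\<^sub>R f x) = c\<^sup>2 * sq_norm \<Omega> f"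
  using assms by (auto simp: L2_def sq_norm_def power_mult_distrib)

lemma L2_diff:
  assumes "f \<in> L2 \<Omega>" "g \<in> L2 \<Omega>"
  shows "(\<lambda>x. f x - g x) \<in> L2 \<Omega>" "sq_norm \<Omega> (\<lambda>x. f x - g x) \<le> 2 * sq_norm \<Omega> f + 2 * sq_norm \<Omega> g"
  using L2_add[OF assms(1) L2_scaleR(1)[OF assms(2), of "-1"]] L2_scaleR(2)[OF assms(2), of "-1"] by auto

lemma integrable_lebesgue_on_lborel:
  fixes f :: "'a::euclidean_space \<Rightarrow> 'b::euclidean_space"
  assumes "integrable lborel f" "\<Omega> \<in> sets lebesgue"
  shows "integrable (lebesgue_on \<Omega>) f"
  using assms integrable_completion[OF borel_measurable_integrable[OF assms(1)]]
  by (simp add: integrable_restrict_space integrable_mult_indicator)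

lemma borel_measurable_lebesgue_on_continuous:
  fixes f :: "'a::euclidean_space \<Rightarrow> 'b::euclidean_space"
  assumes "continuous_on UNIV f"
  shows "f \<in> borel_measurable (lebesgue_on \<Omega>)"
  using borel_measurable_continuous_onI[OF assms]
  by (intro measurable_restrict_space1) (simp add: measurable_completion)

lemma test_functions_L2:
  assumes "f \<in> test_functions \<Omega>" "\<Omega> \<in> sets lebesgue"
  shows "f \<in> L2 \<Omega>"
proof -
  note c = test_functions_continuous[OF assms(1)]
  obtain K where K: "compact K" "\<And>x. x \<notin> K \<Longrightarrow> f x = 0"
    using test_functionsE[OF assms(1)] by metis
  have "continuous_on UNIV (\<lambda>x. (norm (f x))\<^sup>2)"
    by (intro continuous_intros c)
  then have "integrable lborel (\<lambda>x. (norm (f x))\<^sup>2)"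
    using K(2) by (intro continuous_bounded_support_integrable[OF _ K(1)]) auto
  then have "integrable (lebesgue_on \<Omega>) (\<lambda>x. (norm (f x))\<^sup>2)"
    by (rule integrable_lebesgue_on_lborel) (rule assms(2))
  moreover have "f \<in> borel_measurable (lebesgue_on \<Omega>)"
    by (rule borel_measurable_lebesgue_on_continuous[OF c])
  ultimately show ?thesis
    by (simp add: L2_def)
qed

definition test_approximable :: "'a::euclidean_space set \<Rightarrow> ('a \<Rightarrow> 'b::euclidean_space) \<Rightarrow> bool" where
  "test_approximable \<Omega> f \<longleftrightarrow>
     f \<in> L2 \<Omega> \<and> (\<forall>e>0. \<exists>\<phi>\<in>test_functions \<Omega>. sq_norm \<Omega> (\<lambda>x. f x - \<phi> x) < e)"

lemma test_approximable_add:
  assumes "test_approximable \<Omega> f" "test_approximable \<Omega> g" and \<Omega>: "\<Omega> \<in> sets lebesgue"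
  shows "test_approximable \<Omega> (\<lambda>x. f x + g x)"
  unfolding test_approximable_def
proof (intro conjI allI impI)
  show "(\<lambda>x. f x + g x) \<in> L2 \<Omega>"
    using assms L2_add by (auto simp: test_approximable_def)
  fix e :: real assume "e > 0"
  then obtain \<phi> \<psi> where \<phi>\<psi>: "\<phi> \<in> test_functions \<Omega>" "sq_norm \<Omega> (\<lambda>x. f x - \<phi> x) < e / 4"
    "\<psi> \<in> test_functions \<Omega>" "sq_norm \<Omega> (\<lambda>x. g x - \<psi> x) < e / 4"
    using assms unfolding test_approximable_def by (meson divide_pos_pos zero_less_numeral)
  have "(\<lambda>x. f x - \<phi> x) \<in> L2 \<Omega>" "(\<lambda>x. g x - \<psi> x) \<in> L2 \<Omega>"
    using L2_diff(1) test_functions_L2[OF \<phi>\<psi>(1) \<Omega>] test_functions_L2[OF \<phi>\<psi>(3) \<Omega>] assms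
    by (auto simp: test_approximable_def)
  from L2_add(2)[OF this] have "sq_norm \<Omega> (\<lambda>x. (f x + g x) - (\<phi> x + \<psi> x)) < e"
    using \<phi>\<psi> by (simp add: algebra_simps)
  then show "\<exists>\<phi>\<in>test_functions \<Omega>. sq_norm \<Omega> (\<lambda>x. f x + g x - \<phi> x) < e"
    by (rule bexI[where x = "\<lambda>x. \<phi> x + \<psi> x"]) (rule test_functions_add[OF \<phi>\<psi>(1,3)])
qed

text \<open>
  By regularity of Lebesgue measure, \<open>E\<close> lies between a compact \<open>K\<close> and an open \<open>V\<close> of nearly the same
  measure. A smooth cutoff for \<open>K\<close> in \<open>V\<close> differs from the indicator of \<open>E\<close> only on \<open>V - K\<close>, and there
  by at most \<open>1\<close>.
\<close>

lemma test_approximable_indicator: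
  fixes y :: "'b::euclidean_space"
  assumes "open \<Omega>" "bounded \<Omega>" "E \<in> sets lebesgue" "E \<subseteq> \<Omega>"
  shows "test_approximable \<Omega> (\<lambda>x. indicator E x *\<^sub>R y)"
  unfolding test_approximable_def
proof (intro conjI allI impI)
  have \<Omega>: "\<Omega> \<in> sets lebesgue" "\<Omega> \<in> lmeasurable"
    using assms by (auto intro: lmeasurable_open)
  have Em: "E \<in> sets (lebesgue_on \<Omega>)"
    using assms \<Omega> by (simp add: sets_restrict_space_iff)
  have E\<Omega>: "E \<inter> \<Omega> = E"
    using assms by auto
  interpret fin: finite_measure "lebesgue_on \<Omega>"
    by (rule finite_measure_lebesgue_on[OF \<Omega>(2)])
  have "integrable (lebesgue_on \<Omega>) (\<lambda>x. indicator E x * (norm y)\<^sup>2)"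
    using Em by (intro integrable_mult_left) (simp add: integrable_indicator_iff E\<Omega> fin.emeasure_finite less_top[symmetric])
  moreover have "(\<lambda>x. (norm (indicator E x *\<^sub>R y))\<^sup>2) = (\<lambda>x. indicator E x * (norm y)\<^sup>2)"
    by (auto simp: indicator_def)
  ultimately show ind_L2: "(\<lambda>x. indicator E x *\<^sub>R y) \<in> L2 \<Omega>"
    using Em by (simp add: L2_def)
  fix e :: real assume "e > 0"
  define c where "c = (norm y)\<^sup>2 + 1"
  have c: "c > 0"
    by (simp add: c_def add_nonneg_pos)
  define d where "d = e / (2 * c)"
  have d: "d > 0" using \<open>e > 0\<close> c by (simp add: d_def)
  obtain K where K: "closed K" "K \<subseteq> E" "E - K \<in> lmeasurable" "emeasure lebesgue (E - K) < ennreal d"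
    using sets_lebesgue_inner_closed[OF assms(3) d] by metis
  obtain V where V: "open V" "E \<subseteq> V" "V - E \<in> lmeasurable" "emeasure lebesgue (V - E) < ennreal d"
    using sets_lebesgue_outer_open[OF assms(3) d] by metis
  have "compact K"
    using K assms by (meson bounded_subset compact_eq_bounded_closed)
  moreover have "K \<subseteq> V \<inter> \<Omega>" "open (V \<inter> \<Omega>)"
    using K V assms by auto
  ultimately obtain u :: "'a \<Rightarrow> real" where u: "u \<in> test_functions (V \<inter> \<Omega>)" "\<And>x. x \<in> K \<Longrightarrow> u x = 1"
    "\<And>x. 0 \<le> u x" "\<And>x. u x \<le> 1"
    using smooth_urysohn by metis
  have "u \<in> test_functions \<Omega>"
    using u(1) by (auto simp: test_functions_def)
  then have u\<Omega>: "(\<lambda>x. u x *\<^sub>R y) \<in> test_functions \<Omega>"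
    by (rule test_functions_bounded_linear[OF bounded_linear_scaleR_left])
  have u0: "u x = 0" if "x \<notin> V" for x
    using test_functions_outside[OF u(1)] that by auto
  define M where "M = (V - E) \<union> (E - K)"
  have M: "M \<in> lmeasurable" "measure lebesgue M \<le> 2 * d"
  proof -
    show "M \<in> lmeasurable"
      unfolding M_def using K V by blast
    have "measure lebesgue (V - E) < d" "measure lebesgue (E - K) < d"
      using K(3,4) V(3,4) d by (simp_all add: emeasure_eq_measure2 ennreal_less_iff)
    moreover have "measure lebesgue M \<le> measure lebesgue (V - E) + measure lebesgue (E - K)"
      unfolding M_def using K V by (intro measure_Un_le) (auto dest: fmeasurableD)
    ultimately show "measure lebesgue M \<le> 2 * d" by linarith
  qed
  have "sq_norm \<Omega> (\<lambda>x. indicator E x *\<^sub>R y - u x *\<^sub>R y)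
      \<le> (LINT x|lebesgue_on \<Omega>. indicator M x * (norm y)\<^sup>2)"
    unfolding sq_norm_def
  proof (rule integral_mono)
    show "integrable (lebesgue_on \<Omega>) (\<lambda>x. (norm (indicator E x *\<^sub>R y - u x *\<^sub>R y))\<^sup>2)"
      using L2_diff(1)[OF ind_L2 test_functions_L2[OF u\<Omega> \<Omega>(1)]] by (simp add: L2_def)
    have "integrable (lebesgue_on \<Omega>) (indicator M :: 'a \<Rightarrow> real)"
      using fmeasurableD[OF M(1)] \<Omega>(1)
      by (auto simp: integrable_indicator_iff sets_restrict_space_iff fin.emeasure_finite less_top[symmetric])
    then show "integrable (lebesgue_on \<Omega>) (\<lambda>x. indicator M x * (norm y)\<^sup>2)"
      by simp
    fix x
    have "\<bar>indicator E x - u x\<bar> \<le> indicator M x"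
      using u(2)[of x] u(3)[of x] u(4)[of x] u0[of x] K(2) V(2) by (auto simp: M_def indicator_def)
    then have "(indicator E x - u x)\<^sup>2 \<le> (indicator M x)\<^sup>2"
      by (metis abs_ge_zero power2_abs power_mono)
    also have "\<dots> = indicator M x"
      by (simp add: indicator_def)
    finally have "(indicator E x - u x)\<^sup>2 * (norm y)\<^sup>2 \<le> indicator M x * (norm y)\<^sup>2"
      by (rule mult_right_mono) simp
    then show "(norm (indicator E x *\<^sub>R y - u x *\<^sub>R y))\<^sup>2 \<le> indicator M x * (norm y)\<^sup>2"
      by (simp add: scaleR_diff_left[symmetric] power_mult_distrib del: scaleR_diff_left)
  qed
  also have "\<dots> = measure (lebesgue_on \<Omega>) (M \<inter> \<Omega>) * (norm y)\<^sup>2"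
    by simp
  also have "\<dots> \<le> measure lebesgue M * (norm y)\<^sup>2"
    using M(1) \<Omega>(1) by (intro mult_right_mono) (auto simp: measure_restrict_space intro!: measure_mono_fmeasurable dest: fmeasurableD)
  also have "\<dots> \<le> 2 * d * (norm y)\<^sup>2"
    using M(2) by (rule mult_right_mono) simp
  also have "\<dots> < 2 * d * c"
    using d by (simp add: c_def)
  also have "\<dots> = e"
    using c by (simp add: d_def)
  finally show "\<exists>\<phi>\<in>test_functions \<Omega>. sq_norm \<Omega> (\<lambda>x. indicator E x *\<^sub>R y - \<phi> x) < e"
    by (rule bexI[where x = "\<lambda>x. u x *\<^sub>R y"]) (rule u\<Omega>)
qed

lemma test_approximable_sum_indicator:
  fixes s :: "'a::euclidean_space \<Rightarrow> 'b::euclidean_space"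
  assumes "open \<Omega>" "bounded \<Omega>" "finite Y" "\<And>y. y \<in> Y \<Longrightarrow> E y \<in> sets lebesgue" "\<And>y. y \<in> Y \<Longrightarrow> E y \<subseteq> \<Omega>"
  shows "test_approximable \<Omega> (\<lambda>x. \<Sum>y\<in>Y. indicator (E y) x *\<^sub>R (y::'b))"
  using assms(3,4,5)
proof (induction Y rule: finite_induct)
  case empty
  have "test_approximable \<Omega> (\<lambda>x. indicator {} x *\<^sub>R (0::'b))"
    by (rule test_approximable_indicator[OF assms(1,2)]) auto
  then show ?case by simp
next
  case (insert y Y)
  have "test_approximable \<Omega> (\<lambda>x. indicator (E y) x *\<^sub>R y + (\<Sum>y\<in>Y. indicator (E y) x *\<^sub>R y))"
    using insert assms(1) by (intro test_approximable_add test_approximable_indicator assms(1,2)) auto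
  then show ?case
    by (simp only: sum.insert[OF insert(1,2)])
qed

text \<open>
  Every square-integrable function is the pointwise limit of simple functions dominated by a multiple
  of it, hence their limit in \<open>L\<^sup>2\<close>; simple functions are finite sums of indicators.
\<close>

lemma test_functions_dense_L2:
  fixes f :: "'a::euclidean_space \<Rightarrow> 'b::euclidean_space"
  assumes "open \<Omega>" "bounded \<Omega>" "f \<in> L2 \<Omega>" "e > 0"
  obtains \<phi> where "\<phi> \<in> test_functions \<Omega>" "sq_norm \<Omega> (\<lambda>x. f x - \<phi> x) < e"
proof -
  have \<Omega>: "\<Omega> \<in> sets lebesgue"
    using assms by auto
  have f: "f \<in> borel_measurable (lebesgue_on \<Omega>)"
    using assms by (simp add: L2_def)
  obtain s where s: "\<And>i. simple_function (lebesgue_on \<Omega>) (s i)"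
    "\<And>x. x \<in> \<Omega> \<Longrightarrow> (\<lambda>i. s i x) \<longlonglongrightarrow> f x" "\<And>i x. x \<in> \<Omega> \<Longrightarrow> norm (s i x) \<le> 2 * norm (f x)"
    using borel_measurable_implies_sequence_metric[OF f, of 0] by (simp add: dist_norm) metis
  have s_meas: "s i \<in> borel_measurable (lebesgue_on \<Omega>)" for i
    using s(1) by (rule borel_measurable_simple_function)
  have s_L2: "s i \<in> L2 \<Omega>" for i
    by (rule L2_dominated[OF assms(3) s_meas s(3)])
  have "(\<lambda>i. sq_norm \<Omega> (\<lambda>x. f x - s i x)) \<longlonglongrightarrow> (LINT x|lebesgue_on \<Omega>. 0)"
    unfolding sq_norm_def
  proof (rule integral_dominated_convergence)
    show "integrable (lebesgue_on \<Omega>) (\<lambda>x. 9 * (norm (f x))\<^sup>2)"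
      using assms(3) by (simp add: L2_def)
    show "(\<lambda>x. (norm (f x - s i x))\<^sup>2) \<in> borel_measurable (lebesgue_on \<Omega>)" for i
      using f s_meas by measurable
    show "AE x in lebesgue_on \<Omega>. (\<lambda>i. (norm (f x - s i x))\<^sup>2) \<longlonglongrightarrow> 0"
    proof (rule AE_I2)
      fix x assume "x \<in> space (lebesgue_on \<Omega>)"
      then have "(\<lambda>i. s i x) \<longlonglongrightarrow> f x"
        using s(2) by simp
      then have "(\<lambda>i. (norm (f x - s i x))\<^sup>2) \<longlonglongrightarrow> (norm (f x - f x))\<^sup>2"
        by (intro tendsto_intros)
      then show "(\<lambda>i. (norm (f x - s i x))\<^sup>2) \<longlonglongrightarrow> 0"
        by simp
    qed
    show "AE x in lebesgue_on \<Omega>. norm ((norm (f x - s i x))\<^sup>2) \<le> 9 * (norm (f x))\<^sup>2" for i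
    proof (rule AE_I2)
      fix x assume "x \<in> space (lebesgue_on \<Omega>)"
      then have "norm (f x - s i x) \<le> 3 * norm (f x)"
        using norm_triangle_ineq4[of "f x" "s i x"] s(3)[of x i] by simp
      then have "(norm (f x - s i x))\<^sup>2 \<le> (3 * norm (f x))\<^sup>2"
        by (rule power_mono) simp
      then show "norm ((norm (f x - s i x))\<^sup>2) \<le> 9 * (norm (f x))\<^sup>2"
        by (simp add: power_mult_distrib)
    qed
  qed simp
  then have "eventually (\<lambda>i. sq_norm \<Omega> (\<lambda>x. f x - s i x) < e / 4) sequentially"
    using assms(4) by (auto dest: order_tendstoD(2)[where a = "e / 4"])
  then obtain i where i: "sq_norm \<Omega> (\<lambda>x. f x - s i x) < e / 4"
    by (auto simp: eventually_sequentially)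
  define E where "E y = s i -` {y} \<inter> \<Omega>" for y
  have fin: "finite (s i ` \<Omega>)"
    using s(1)[of i] by (simp add: simple_function_def)
  have E_meas: "E y \<in> sets lebesgue" for y
    using simple_functionD(2)[OF s(1)[of i], of "{y}"] \<Omega> by (simp add: E_def sets_restrict_space_iff)
  have "test_approximable \<Omega> (\<lambda>x. \<Sum>y\<in>s i ` \<Omega>. indicator (E y) x *\<^sub>R y)"
    by (rule test_approximable_sum_indicator[OF assms(1,2) fin E_meas]) (simp add: E_def)
  then obtain \<phi> where \<phi>: "\<phi> \<in> test_functions \<Omega>"
    "sq_norm \<Omega> (\<lambda>x. (\<Sum>y\<in>s i ` \<Omega>. indicator (E y) x *\<^sub>R y) - \<phi> x) < e / 4"
    using assms(4) unfolding test_approximable_def by (meson divide_pos_pos zero_less_numeral)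
  have "(\<Sum>y\<in>s i ` \<Omega>. indicator (E y) x *\<^sub>R y) = s i x" if "x \<in> \<Omega>" for x
  proof -
    have "(\<Sum>y\<in>s i ` \<Omega>. indicator (E y) x *\<^sub>R y) = (\<Sum>y\<in>s i ` \<Omega>. if y = s i x then y else 0)"
      using that by (intro sum.cong) (auto simp: E_def indicator_def)
    also have "\<dots> = s i x"
      using fin that by (simp add: sum.delta')
    finally show ?thesis .
  qed
  then have "sq_norm \<Omega> (\<lambda>x. (\<Sum>y\<in>s i ` \<Omega>. indicator (E y) x *\<^sub>R y) - \<phi> x) = sq_norm \<Omega> (\<lambda>x. s i x - \<phi> x)"
    unfolding sq_norm_def by (intro Bochner_Integration.integral_cong) auto
  then have "sq_norm \<Omega> (\<lambda>x. s i x - \<phi> x) < e / 4"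
    using \<phi>(2) by simp
  moreover have "sq_norm \<Omega> (\<lambda>x. f x - \<phi> x) \<le> 2 * sq_norm \<Omega> (\<lambda>x. f x - s i x) + 2 * sq_norm \<Omega> (\<lambda>x. s i x - \<phi> x)"
    using L2_add(2)[OF L2_diff(1)[OF assms(3) s_L2[of i]] L2_diff(1)[OF s_L2[of i] test_functions_L2[OF \<phi>(1) \<Omega>]]]
    by simp
  ultimately show ?thesis
    using i that[OF \<phi>(1)] by simp
qed

section \<open>Approximation of square-integrable kernels by kernels of finite rank\<close>

text \<open>
  A kernel of finite rank, given by the list of its factors.
\<close>

definition tensor_sum :: "(('a \<Rightarrow> real) \<times> ('b \<Rightarrow> real)) list \<Rightarrow> 'a \<Rightarrow> 'b \<Rightarrow> real" where
  "tensor_sum ps x y = (\<Sum>(a, b)\<leftarrow>ps. a x * b y)"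

definition continuous_tensor ::
    "(('a::topological_space \<Rightarrow> real) \<times> ('b::topological_space \<Rightarrow> real)) list \<Rightarrow> bool" where
  "continuous_tensor ps \<longleftrightarrow>
     (\<forall>(a, b)\<in>set ps. continuous_on UNIV a \<and> continuous_on UNIV b)"

lemma tensor_sum_simps [simp]:
  "tensor_sum [] x y = 0"
  "tensor_sum ((a, b) # ps) x y = a x * b y + tensor_sum ps x y"
  "tensor_sum (ps @ qs) x y = tensor_sum ps x y + tensor_sum qs x y"
  by (simp_all add: tensor_sum_def)

lemma continuous_tensor_simps [simp]:
  "continuous_tensor []"
  "continuous_tensor ((a, b) # ps) \<longleftrightarrow>
     continuous_on UNIV a \<and> continuous_on UNIV b \<and> continuous_tensor ps"
  "continuous_tensor (ps @ qs) \<longleftrightarrow> continuous_tensor ps \<and> continuous_tensor qs"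
  by (auto simp: continuous_tensor_def)

lemma tensor_sum_scale:
  assumes "continuous_on UNIV a" "continuous_on UNIV b" "continuous_tensor qs"
  obtains rs where "continuous_tensor rs" "\<And>x y. tensor_sum rs x y = a x * b y * tensor_sum qs x y"
proof -
  have "\<exists>rs. continuous_tensor rs \<and> (\<forall>x y. tensor_sum rs x y = a x * b y * tensor_sum qs x y)"
    using assms(3)
  proof (induction qs)
    case Nil
    show ?case by (rule exI[of _ "[]"]) simp
  next
    case (Cons q qs)
    obtain c d where q: "q = (c, d)" by fastforce
    then obtain rs where rs: "continuous_tensor rs" "\<forall>x y. tensor_sum rs x y = a x * b y * tensor_sum qs x y"
      using Cons by auto
    show ?case
      by (rule exI[of _ "(\<lambda>x. a x * c x, \<lambda>y. b y * d y) # rs"])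
        (use assms(1,2) Cons.prems rs q in \<open>auto intro!: continuous_on_mult simp: algebra_simps\<close>)
  qed
  then show ?thesis using that by auto
qed

lemma tensor_sum_mult:
  assumes "continuous_tensor ps" "continuous_tensor qs"
  obtains rs where "continuous_tensor rs" "\<And>x y. tensor_sum rs x y = tensor_sum ps x y * tensor_sum qs x y"
proof -
  have "\<exists>rs. continuous_tensor rs \<and> (\<forall>x y. tensor_sum rs x y = tensor_sum ps x y * tensor_sum qs x y)"
    using assms(1)
  proof (induction ps)
    case Nil
    show ?case by (rule exI[of _ "[]"]) simp
  next
    case (Cons p ps)
    obtain a b where p: "p = (a, b)" by fastforce
    then obtain rs where rs: "continuous_tensor rs" "\<forall>x y. tensor_sum rs x y = tensor_sum ps x y * tensor_sum qs x y"
      using Cons by auto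
    obtain ts where ts: "continuous_tensor ts" "\<And>x y. tensor_sum ts x y = a x * b y * tensor_sum qs x y"
      using tensor_sum_scale[of a b qs] Cons.prems assms(2) p by auto
    show ?case
      by (rule exI[of _ "ts @ rs"]) (use rs ts p in \<open>auto simp: algebra_simps\<close>)
  qed
  then show ?thesis using that by auto
qed

text \<open>
  A linear function of \<open>(x, y)\<close> splits as \<open>f(x, 0) + f(0, y)\<close>, and kernels of finite rank form an
  algebra.
\<close>

lemma real_polynomial_function_tensor_sum:
  fixes p :: "'a::euclidean_space \<times> 'b::euclidean_space \<Rightarrow> real"
  assumes "real_polynomial_function p"
  obtains ps where "continuous_tensor ps" "\<And>x y. p (x, y) = tensor_sum ps x y"
proof -
  have "\<exists>ps. continuous_tensor ps \<and> (\<forall>x y. p (x, y) = tensor_sum ps x y)"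
    using assms
  proof (induction p rule: real_polynomial_function.induct)
    case (linear f)
    let ?ps = "[(\<lambda>x. f (x, 0), \<lambda>y. 1), (\<lambda>x. 1, \<lambda>y. f (0, y))]"
    have c: "continuous_on UNIV f"
      by (rule bounded_linear.continuous_on[OF linear continuous_on_id])
    have "continuous_on UNIV (\<lambda>x. f (x, 0))"
      by (rule continuous_on_compose2[OF c continuous_on_Pair[OF continuous_on_id continuous_on_const]]) simp
    moreover have "continuous_on UNIV (\<lambda>y. f (0, y))"
      by (rule continuous_on_compose2[OF c continuous_on_Pair[OF continuous_on_const continuous_on_id]]) simp
    ultimately have "continuous_tensor ?ps"
      by simp
    moreover have "f (x, y) = tensor_sum ?ps x y" for x y
    proof -
      have "f (x, y) = f ((x, 0) + (0, y))"
        by simp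
      also have "\<dots> = f (x, 0) + f (0, y)"
        by (rule linear_add[OF bounded_linear.linear[OF linear]])
      also have "\<dots> = tensor_sum ?ps x y"
        by simp
      finally show ?thesis .
    qed
    ultimately show ?case
      by (intro exI[of _ ?ps] conjI allI)
  next
    case (const c)
    show ?case
      by (rule exI[of _ "[(\<lambda>x. c, \<lambda>y. 1)]"]) auto
  next
    case (add f g)
    then obtain ps qs where "continuous_tensor ps" "\<forall>x y. f (x, y) = tensor_sum ps x y"
      "continuous_tensor qs" "\<forall>x y. g (x, y) = tensor_sum qs x y"
      by auto
    then show ?case
      by (intro exI[of _ "ps @ qs"]) auto
  next
    case (mult f g)
    then obtain ps qs where *: "continuous_tensor ps" "\<forall>x y. f (x, y) = tensor_sum ps x y"
      "continuous_tensor qs" "\<forall>x y. g (x, y) = tensor_sum qs x y"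
      by auto
    obtain rs where "continuous_tensor rs" "\<And>x y. tensor_sum rs x y = tensor_sum ps x y * tensor_sum qs x y"
      using tensor_sum_mult[OF *(1,3)] by blast
    then show ?case
      using * by (intro exI[of _ rs]) auto
  qed
  then show ?thesis using that by auto
qed

lemma continuous_on_tensor_sum:
  assumes "continuous_tensor ps"
  shows "continuous_on UNIV (\<lambda>z. tensor_sum ps (fst z) (snd z))"
  using assms
proof (induction ps)
  case (Cons p ps)
  obtain a b where p: "p = (a, b)" by fastforce
  with Cons.prems have ab: "continuous_on UNIV a" "continuous_on UNIV b"
    by auto
  have "continuous_on UNIV (\<lambda>z. a (fst z) * b (snd z))"
    by (intro continuous_on_mult continuous_on_compose2[OF ab(1)] continuous_on_compose2[OF ab(2)] continuous_intros) auto
  then show ?case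
    using Cons p by (auto intro: continuous_on_add)
qed simp

lemma L2_bounded:
  assumes "\<Omega> \<in> lmeasurable" "f \<in> borel_measurable (lebesgue_on \<Omega>)" "\<And>x. x \<in> \<Omega> \<Longrightarrow> norm (f x) \<le> c"
  shows "f \<in> L2 \<Omega>" "sq_norm \<Omega> f \<le> c\<^sup>2 * measure lebesgue \<Omega>"
proof -
  interpret finite_measure "lebesgue_on \<Omega>"
    by (rule finite_measure_lebesgue_on[OF assms(1)])
  have bd: "(norm (f x))\<^sup>2 \<le> c\<^sup>2" if "x \<in> \<Omega>" for x
    using assms(3)[OF that] by (simp add: power_mono)
  have int: "integrable (lebesgue_on \<Omega>) (\<lambda>x. (norm (f x))\<^sup>2)"
    by (rule integrable_const_bound[where B = "c\<^sup>2"]) (use assms(2) bd in \<open>auto intro!: AE_I2\<close>)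
  then show "f \<in> L2 \<Omega>"
    using assms(2) by (simp add: L2_def)
  have "sq_norm \<Omega> f \<le> (LINT x|lebesgue_on \<Omega>. c\<^sup>2)"
    unfolding sq_norm_def by (rule integral_mono[OF int]) (use bd in auto)
  also have "\<dots> = c\<^sup>2 * measure lebesgue \<Omega>"
    using assms(1) by (simp add: measure_restrict_space fmeasurableD mult.commute)
  finally show "sq_norm \<Omega> f \<le> c\<^sup>2 * measure lebesgue \<Omega>" .
qed

text \<open>
  First approximate \<open>k\<close> in \<open>L\<^sup>2\<close> by a test function on \<open>\<Omega> \<times> \<Omega>\<close>, then that function uniformly by a
  polynomial, which is of finite rank. On a set of finite measure uniform approximation controls the
  \<open>L\<^sup>2\<close> distance.
\<close>

lemma L2_kernel_finite_rank_approximation: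
  fixes k :: "'a::euclidean_space \<times> 'a \<Rightarrow> real"
  assumes "open \<Omega>" "bounded \<Omega>" "k \<in> L2 (\<Omega> \<times> \<Omega>)" "e > 0"
  obtains ps where "continuous_tensor ps"
    "(\<lambda>z. k z - tensor_sum ps (fst z) (snd z)) \<in> L2 (\<Omega> \<times> \<Omega>)"
    "sq_norm (\<Omega> \<times> \<Omega>) (\<lambda>z. k z - tensor_sum ps (fst z) (snd z)) < e"
proof -
  have \<Omega>2: "open (\<Omega> \<times> \<Omega>)" "bounded (\<Omega> \<times> \<Omega>)"
    using assms by (auto intro: open_Times bounded_Times)
  have \<Omega>2m: "\<Omega> \<times> \<Omega> \<in> lmeasurable" "\<Omega> \<times> \<Omega> \<in> sets lebesgue"
    using \<Omega>2 lmeasurable_open by auto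
  obtain \<kappa> where \<kappa>: "\<kappa> \<in> test_functions (\<Omega> \<times> \<Omega>)" "sq_norm (\<Omega> \<times> \<Omega>) (\<lambda>z. k z - \<kappa> z) < e / 4"
    using test_functions_dense_L2[OF \<Omega>2 assms(3), of "e / 4"] assms(4) by auto
  define m where "m = measure lebesgue (\<Omega> \<times> \<Omega>) + 1"
  have m: "m > 0" "measure lebesgue (\<Omega> \<times> \<Omega>) < m"
    by (simp_all add: m_def add_nonneg_pos)
  \<comment> \<open>The uniform error \<open>d\<close> costs \<open>d\<^sup>2\<close> times the measure of \<open>\<Omega> \<times> \<Omega>\<close>; adding \<open>1\<close> to the measure
    keeps \<open>m\<close> positive when \<open>\<Omega>\<close> is empty.\<close>
  define d where "d = sqrt (e / (4 * m))"
  have d: "d > 0" "d\<^sup>2 * m = e / 4"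
    using assms(4) m by (simp_all add: d_def)
  have "compact (closure (\<Omega> \<times> \<Omega>))"
    using \<Omega>2 by simp
  then obtain p where p: "real_polynomial_function p" "\<And>z. z \<in> closure (\<Omega> \<times> \<Omega>) \<Longrightarrow> \<bar>\<kappa> z - p z\<bar> < d"
    using Stone_Weierstrass_real_polynomial_function[of "closure (\<Omega> \<times> \<Omega>)" \<kappa> d]
      continuous_on_subset[OF test_functions_continuous[OF \<kappa>(1)]] d by blast
  obtain ps where ps: "continuous_tensor ps" "\<And>x y. p (x, y) = tensor_sum ps x y"
    using real_polynomial_function_tensor_sum[OF p(1)] by metis
  let ?t = "\<lambda>z. tensor_sum ps (fst z) (snd z)"
  have cont: "continuous_on UNIV (\<lambda>z. \<kappa> z - ?t z)"
    by (intro continuous_on_diff test_functions_continuous[OF \<kappa>(1)] continuous_on_tensor_sum[OF ps(1)])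
  have "norm (\<kappa> z - ?t z) \<le> d" if "z \<in> \<Omega> \<times> \<Omega>" for z
    using p(2)[of z] that closure_subset[of "\<Omega> \<times> \<Omega>"] ps(2)[of "fst z" "snd z"] by force
  note \<kappa>t = L2_bounded[OF \<Omega>2m(1) borel_measurable_lebesgue_on_continuous[OF cont] this]
  note k\<kappa> = L2_diff(1)[OF assms(3) test_functions_L2[OF \<kappa>(1) \<Omega>2m(2)]]
  have "d\<^sup>2 * measure lebesgue (\<Omega> \<times> \<Omega>) \<le> e / 4"
    using mult_left_mono[OF less_imp_le[OF m(2)], of "d\<^sup>2"] d(2) by simp
  moreover have "(\<lambda>z. k z - ?t z) \<in> L2 (\<Omega> \<times> \<Omega>)"
    "sq_norm (\<Omega> \<times> \<Omega>) (\<lambda>z. k z - ?t z)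
      \<le> 2 * sq_norm (\<Omega> \<times> \<Omega>) (\<lambda>z. k z - \<kappa> z) + 2 * sq_norm (\<Omega> \<times> \<Omega>) (\<lambda>z. \<kappa> z - ?t z)"
    using L2_add[OF k\<kappa> \<kappa>t(1)] by simp_all
  ultimately show ?thesis
    using that[OF ps(1)] \<kappa>t(2) \<kappa>(2) by simp
qed

section \<open>The energy as a bilinear form with kernel given by the Laplacian\<close>

text \<open>
  Fubini's theorem and changes of variables need Borel functions on \<open>lborel\<close>, whereas the functions
  under study are only Lebesgue measurable. This lemma passes between the two.
\<close>

lemma integral_lebesgue_eq_lborel:
  fixes f h :: "'a::euclidean_space \<Rightarrow> real"
  assumes h: "h \<in> borel_measurable borel" and ae: "AE x in lborel. f x = h x"
  shows "(LINT x|lebesgue. f x) = (LINT x|lborel. h x)"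
    "integrable lebesgue f \<longleftrightarrow> integrable lborel h"
proof -
  have h': "h \<in> borel_measurable lborel" and hL: "h \<in> borel_measurable lebesgue"
    using h by (simp_all add: measurable_completion)
  have ae': "AE x in lebesgue. h x = f x"
    using AE_completion[OF ae] by (simp add: eq_commute)
  then have f: "f \<in> borel_measurable lebesgue"
    by (rule borel_measurable_AE[OF hL])
  show "(LINT x|lebesgue. f x) = (LINT x|lborel. h x)"
    using integral_cong_AE[OF hL f ae'] integral_completion[OF h'] by simp
  show "integrable lebesgue f \<longleftrightarrow> integrable lborel h"
    using integrable_cong_AE[OF hL f ae'] integrable_completion[OF h'] by simp
qed

lemma borel_version_on_compact:
  fixes \<alpha> :: "'a::euclidean_space \<Rightarrow> real"
  assumes "\<alpha> locally_integrable_on U" "compact K" "K \<subseteq> U"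
  obtains g where "integrable lborel g" "AE d in lborel. g d = indicator K d * \<alpha> d"
proof -
  have "integrable (lebesgue_on K) \<alpha>"
    using assms by (simp add: locally_integrable_on_def)
  then have int: "integrable lebesgue (\<lambda>d. indicator K d * \<alpha> d)"
    using assms(2) by (simp add: integrable_restrict_space compact_imp_closed)
  obtain g where g: "g \<in> borel_measurable lborel" "AE d in lborel. indicator K d * \<alpha> d = g d"
    using completion_ex_borel_measurable_real[OF borel_measurable_integrable[OF int]] by auto
  have "integrable lborel g"
    using integral_lebesgue_eq_lborel(2)[OF _ g(2)] g(1) int by simp
  then show ?thesis
    using that g(2) by (simp add: eq_commute)
qed

lemma lborel_distr_reflect: "distr lborel borel (\<lambda>y. x - y) = (lborel :: 'a::euclidean_space measure)"
  using lborel_affine[of "-1" x] by (simp add: density_1)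

lemma lborel_integrable_reflect:
  fixes g :: "'a::euclidean_space \<Rightarrow> 'b::euclidean_space"
  assumes "integrable lborel g"
  shows "integrable lborel (\<lambda>y. g (x - y))" "(LINT y|lborel. g (x - y)) = (LINT y|lborel. g y)"
proof -
  have m: "g \<in> borel_measurable borel"
    using borel_measurable_integrable[OF assms] by simp
  show "integrable lborel (\<lambda>y. g (x - y))"
    using integrable_distr_eq[of "\<lambda>y. x - y" lborel borel g] m assms by (simp add: lborel_distr_reflect)
  show "(LINT y|lborel. g (x - y)) = (LINT y|lborel. g y)"
    using integral_distr[of "\<lambda>y. x - y" lborel borel g] m by (simp add: lborel_distr_reflect)
qed

lemma AE_lborel_reflect:
  assumes "AE d in lborel. P d"
  shows "AE y in lborel. P (x - (y::'a::euclidean_space))"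
proof (rule AE_distrD[where M' = lborel])
  show "(\<lambda>y. x - y) \<in> lborel \<rightarrow>\<^sub>M lborel" by simp
  show "AE d in distr lborel lborel (\<lambda>y. x - y). P d"
  proof -
    have "distr lborel lborel (\<lambda>y. x - y) = distr lborel borel (\<lambda>y. x - y)"
      by (rule distr_cong) auto
    then show ?thesis
      unfolding lborel_distr_reflect using assms by (simp only:)
  qed
qed

text \<open>
  If a property of \<open>d\<close> fails on a null set \<open>N\<close>, each slice \<open>{y. x - y \<in> N}\<close> is null, being a reflected
  translate of \<open>N\<close>; by Fubini's theorem so is \<open>{(x, y). x - y \<in> N}\<close>.
\<close>

lemma AE_lborel_difference:
  assumes "AE d in lborel. P d"
  shows "AE z in lborel. P (fst z - (snd z::'a::euclidean_space))"
proof -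
  obtain N where N: "N \<in> null_sets lborel" "\<And>d. d \<notin> N \<Longrightarrow> P d"
    using assms by (auto simp: eventually_ae_filter)
  have Nb: "N \<in> sets borel"
    using N(1) by auto
  have "AE y in lborel. x - y \<notin> N" for x
    by (rule AE_lborel_reflect) (rule AE_not_in[OF N(1)])
  then have "AE z in lborel \<Otimes>\<^sub>M lborel. fst z - snd z \<notin> N"
  proof (intro lborel_pair.AE_pair_measure)
    show "{z \<in> space (lborel \<Otimes>\<^sub>M lborel). fst z - snd z \<notin> N} \<in> sets (lborel \<Otimes>\<^sub>M lborel)"
      using Nb by measurable
  qed simp
  then have "AE z in lborel. fst z - snd z \<notin> N"
    unfolding lborel_prod .
  then show ?thesis
    by (rule eventually_mono) (rule N(2))
qed

lemma compactly_supported_bounded: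
  fixes F :: "'a::euclidean_space \<Rightarrow> 'b::euclidean_space"
  assumes "continuous_on UNIV F" "compact K" "\<And>x. x \<notin> K \<Longrightarrow> F x = 0"
  obtains M where "M \<ge> 0" "\<And>x. norm (F x) \<le> M"
proof -
  have "bounded (F ` K)"
    using assms by (meson compact_continuous_image compact_imp_bounded continuous_on_subset subset_UNIV)
  then obtain M where M: "\<And>x. x \<in> K \<Longrightarrow> norm (F x) \<le> M"
    by (auto simp: bounded_iff)
  have "norm (F x) \<le> max M 0" for x
    using M[of x] assms(3)[of x] by (cases "x \<in> K") auto
  then show ?thesis
    using that[of "max M 0"] by simp
qed

text \<open>
  The substitution \<open>d = x - y\<close> followed by an exchange of integrals. Both the iterated and the product
  form are stated: the first matches the definition of the energy, the second is suited to \<open>L\<^sup>2\<close>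
  estimates on the product.
\<close>

lemma convolution_form:
  fixes g :: "'a::euclidean_space \<Rightarrow> real" and F G :: "'a \<Rightarrow> 'b::euclidean_space"
  assumes g: "integrable lborel g"
    and F: "continuous_on UNIV F" "compact K" "\<And>x. x \<notin> K \<Longrightarrow> F x = 0"
    and G: "continuous_on UNIV G" "compact K'" "\<And>x. x \<notin> K' \<Longrightarrow> G x = 0"
  shows "(LINT x|lborel. LINT y|lborel. g (x - y) * (F x \<bullet> G y)) = (LINT d|lborel. g d * correlation F G d)"
    "(LINT z|lborel. g (fst z - snd z) * (F (fst z) \<bullet> G (snd z))) = (LINT d|lborel. g d * correlation F G d)"
proof -
  have [measurable]: "g \<in> borel_measurable borel"
    using borel_measurable_integrable[OF g] by simp
  have [measurable]: "F \<in> borel_measurable borel" "G \<in> borel_measurable borel"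
    using F(1) G(1) by (auto intro: borel_measurable_continuous_onI)
  obtain M where M: "M \<ge> 0" "\<And>x. norm (G x) \<le> M"
    using compactly_supported_bounded[OF G] by metis
  have F_int: "integrable lborel (\<lambda>x. norm (F x))"
    using continuous_bounded_support_integrable[OF F] by simp
  have bound: "norm (s * (F x \<bullet> G y)) \<le> \<bar>s\<bar> * (norm (F x) * M)" for s x y
  proof -
    have "\<bar>F x \<bullet> G y\<bar> \<le> norm (F x) * norm (G y)"
      by (rule Cauchy_Schwarz_ineq2)
    also have "\<dots> \<le> norm (F x) * M"
      using M by (intro mult_left_mono) auto
    finally show ?thesis
      by (simp add: abs_mult mult_left_mono)
  qed
  let ?f = "\<lambda>(x, y). g (x - y) * (F x \<bullet> G y)"
  \<comment> \<open>The integrand \<open>?f\<close> in the coordinates \<open>(d, x)\<close> with \<open>d = x - y\<close>.\<close>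
  let ?h = "\<lambda>(d, x). g d * (F x \<bullet> G (x - d))"
  have g_int: "integrable lborel (\<lambda>y. \<bar>g (x - y)\<bar> * c)" for x c
    using lborel_integrable_reflect(1)[OF g, of x] by simp
  have f_int1: "integrable lborel (\<lambda>y. g (x - y) * (F x \<bullet> G y))" for x
  proof (rule Bochner_Integration.integrable_bound[OF g_int[of x "norm (F x) * M"]])
    show "AE y in lborel. norm (g (x - y) * (F x \<bullet> G y)) \<le> norm (\<bar>g (x - y)\<bar> * (norm (F x) * M))"
      by (intro AE_I2 order_trans[OF bound]) simp
  qed simp
  have f_int: "integrable (lborel \<Otimes>\<^sub>M lborel) ?f"
  proof (rule lborel_pair.Fubini_integrable)
    show "?f \<in> borel_measurable (lborel \<Otimes>\<^sub>M lborel)"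
      by measurable
    have "(LINT y|lborel. norm (g (x - y) * (F x \<bullet> G y))) \<le> (LINT y|lborel. \<bar>g y\<bar>) * (norm (F x) * M)" for x
    proof -
      have "(LINT y|lborel. norm (g (x - y) * (F x \<bullet> G y))) \<le> (LINT y|lborel. \<bar>g (x - y)\<bar> * (norm (F x) * M))"
        by (intro integral_mono g_int integrable_norm f_int1 bound)
      also have "\<dots> = (LINT y|lborel. \<bar>g y\<bar>) * (norm (F x) * M)"
        using lborel_integrable_reflect(2)[OF integrable_abs[OF g], of x] by simp
      finally show ?thesis .
    qed
    then have "norm (LINT y|lborel. norm (?f (x, y))) \<le> norm ((LINT y|lborel. \<bar>g y\<bar>) * (norm (F x) * M))" for x
      by (auto simp: abs_of_nonneg integral_nonneg_AE intro: order_trans[OF _ abs_ge_self])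
    moreover have "integrable lborel (\<lambda>x. (LINT y|lborel. \<bar>g y\<bar>) * (norm (F x) * M))"
      using F_int by simp
    ultimately show "integrable lborel (\<lambda>x. LINT y|lborel. norm (?f (x, y)))"
      by (elim Bochner_Integration.integrable_bound) (auto intro!: AE_I2)
  qed (use f_int1 in auto)
  have h_int1: "integrable lborel (\<lambda>x. g d * (F x \<bullet> G (x - d)))" for d
  proof (rule Bochner_Integration.integrable_bound)
    show "integrable lborel (\<lambda>x. \<bar>g d\<bar> * (norm (F x) * M))"
      using F_int by simp
    show "AE x in lborel. norm (g d * (F x \<bullet> G (x - d))) \<le> norm (\<bar>g d\<bar> * (norm (F x) * M))"
      by (intro AE_I2 order_trans[OF bound]) simp
  qed simp
  have h_int: "integrable (lborel \<Otimes>\<^sub>M lborel) ?h"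
  proof (rule lborel_pair.Fubini_integrable)
    show "?h \<in> borel_measurable (lborel \<Otimes>\<^sub>M lborel)"
      by measurable
    have "(LINT x|lborel. norm (g d * (F x \<bullet> G (x - d)))) \<le> \<bar>g d\<bar> * (LINT x|lborel. norm (F x) * M)" for d
    proof -
      have "(LINT x|lborel. norm (g d * (F x \<bullet> G (x - d)))) \<le> (LINT x|lborel. \<bar>g d\<bar> * (norm (F x) * M))"
        using F_int by (intro integral_mono integrable_norm h_int1 bound) simp
      then show ?thesis by simp
    qed
    then have "norm (LINT x|lborel. norm (?h (d, x))) \<le> norm (\<bar>g d\<bar> * (LINT x|lborel. norm (F x) * M))" for d
      by (auto simp: abs_of_nonneg integral_nonneg_AE intro: order_trans[OF _ abs_ge_self])
    moreover have "integrable lborel (\<lambda>d. \<bar>g d\<bar> * (LINT x|lborel. norm (F x) * M))"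
      using g by simp
    ultimately show "integrable lborel (\<lambda>d. LINT x|lborel. norm (?h (d, x)))"
      by (elim Bochner_Integration.integrable_bound) (auto intro!: AE_I2)
  qed (use h_int1 in auto)
  have "(LINT y|lborel. g (x - y) * (F x \<bullet> G y)) = (LINT d|lborel. g d * (F x \<bullet> G (x - d)))" for x
    using lborel_integrable_reflect(2)[OF f_int1[of x], of x] by simp
  then have "(LINT x|lborel. LINT y|lborel. g (x - y) * (F x \<bullet> G y))
      = (LINT x|lborel. LINT d|lborel. g d * (F x \<bullet> G (x - d)))"
    by simp
  also have "\<dots> = (LINT d|lborel. LINT x|lborel. g d * (F x \<bullet> G (x - d)))"
    using lborel_pair.Fubini_integral[of "\<lambda>d x. g d * (F x \<bullet> G (x - d))"] h_int by simp
  also have "\<dots> = (LINT d|lborel. g d * correlation F G d)"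
  proof -
    have "(LINT x|lborel. F x \<bullet> G (x - d)) = correlation F G d" for d
      using lborel_integral_shift[of "\<lambda>x. F x \<bullet> G (x - d)" d] by (simp add: correlation_def add.commute)
    then show ?thesis by simp
  qed
  finally show *: "(LINT x|lborel. LINT y|lborel. g (x - y) * (F x \<bullet> G y)) = (LINT d|lborel. g d * correlation F G d)" .
  show "(LINT z|lborel. g (fst z - snd z) * (F (fst z) \<bullet> G (snd z))) = (LINT d|lborel. g d * correlation F G d)"
    using lborel_pair.integral_fst'[OF f_int] * by (simp add: lborel_prod case_prod_unfold)
qed

lemma inner_jacobian:
  fixes u v :: "real^'n \<Rightarrow> real^'n"
  shows "jacobian u (at x) \<bullet> jacobian v (at y)
    = (\<Sum>b\<in>Basis. frechet_derivative u (at x) b \<bullet> frechet_derivative v (at y) b)"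
proof -
  have "(\<Sum>b\<in>Basis. frechet_derivative u (at x) b \<bullet> frechet_derivative v (at y) b)
      = (\<Sum>m\<in>UNIV. frechet_derivative u (at x) (axis m 1) \<bullet> frechet_derivative v (at y) (axis m 1))"
    by (simp add: sum.reindex Basis_vec_def inj_on_def axis_eq_axis UNION_singleton_eq_range)
  then show ?thesis
    by (simp add: jacobian_def matrix_def inner_vec_def) (rule sum.swap)
qed

lemma jacobian_test_function:
  fixes u :: "real^'n \<Rightarrow> real^'n"
  assumes u: "u \<in> test_functions \<Omega>" and K: "compact K" "\<And>x. x \<notin> K \<Longrightarrow> u x = 0"
  shows "continuous_on UNIV (\<lambda>x. jacobian u (at x))" "\<And>x. x \<notin> K \<Longrightarrow> jacobian u (at x) = 0"
proof -
  have "continuous_on UNIV (\<lambda>x. frechet_derivative u (at x) v)" for v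
    by (rule test_functions_continuous[OF test_functions_deriv[OF u]])
  then show "continuous_on UNIV (\<lambda>x. jacobian u (at x))"
    unfolding jacobian_def matrix_def by (intro continuous_intros)
  show "jacobian u (at x) = 0" if "x \<notin> K" for x
    using frechet_derivative_outside_support[OF compact_imp_closed[OF K(1)] K(2) that]
    by (simp add: jacobian_def matrix_def vec_eq_iff)
qed

lemma correlation_jacobian:
  fixes u v :: "real^'n \<Rightarrow> real^'n"
  assumes u: "u \<in> test_functions \<Omega>" and v: "v \<in> test_functions \<Omega>"
  shows "correlation (\<lambda>x. jacobian u (at x)) (\<lambda>x. jacobian v (at x)) d = - laplacian (correlation u v) d"
proof -
  have "integrable lborel (\<lambda>y. frechet_derivative u (at (y + d)) b \<bullet> frechet_derivative v (at y) b)" for b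
  proof -
    let ?u' = "\<lambda>x. frechet_derivative u (at x) b" and ?v' = "\<lambda>x. frechet_derivative v (at x) b"
    have t: "?u' \<in> test_functions \<Omega>" "?v' \<in> test_functions \<Omega>"
      using u v test_functions_deriv by blast+
    obtain K where K: "compact K" "\<And>x. x \<notin> K \<Longrightarrow> ?v' x = 0"
      using test_functionsE[OF t(2)] by metis
    have "continuous_on UNIV (\<lambda>y. ?u' (y + d))"
      by (rule continuous_on_compose2[OF test_functions_continuous[OF t(1)]]) (auto intro!: continuous_intros)
    then have "continuous_on UNIV (\<lambda>y. ?u' (y + d) \<bullet> ?v' y)"
      by (rule continuous_on_inner) (rule test_functions_continuous[OF t(2)])
    then show ?thesis
      by (rule continuous_bounded_support_integrable[OF _ K(1)]) (simp add: K(2))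
  qed
  then show ?thesis
    by (simp add: laplacian_correlation[OF u v] correlation_def inner_jacobian)
qed

text \<open>
  The supports of \<open>u\<close> and \<open>v\<close> are compact subsets of \<open>\<Omega>\<close>, so only values of \<open>\<alpha>\<close> and \<open>L\<close> on the compact
  set \<open>K\<close> of differences of support points matter. There both are integrable and may be replaced by
  Borel versions, to which \<open>convolution_form\<close> applies. The weak Laplacian is tested against the
  correlation of \<open>u\<close> and \<open>v\<close>.
\<close>

proposition kernel_inner_eq_laplacian_form:
  fixes \<Omega> :: "(real^'n) set" and \<alpha> L :: "real^'n \<Rightarrow> real"
  assumes lap: "has_weak_laplacian {x - x' | x x'. x \<in> \<Omega> \<and> x' \<in> \<Omega>} \<alpha> L"
    and \<Omega>: "open \<Omega>"
    and u: "u \<in> test_functions \<Omega>" and v: "v \<in> test_functions \<Omega>"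
  shows "kernel_inner \<Omega> (\<lambda>x x'. \<alpha> (x - x')) u v
    = - (LINT z|lebesgue_on (\<Omega> \<times> \<Omega>). L (fst z - snd z) * (u (fst z) \<bullet> v (snd z)))"
proof -
  define U where "U = {x - x' | x x'. x \<in> \<Omega> \<and> x' \<in> \<Omega>}"
  have U: "open U"
  proof -
    have "U = (\<Union>y\<in>\<Omega>. (\<lambda>x. x - y) ` \<Omega>)"
      by (auto simp: U_def)
    then show ?thesis
      by (simp add: open_UN open_translation_subtract \<Omega>)
  qed
  have \<Omega>m: "\<Omega> \<in> sets lebesgue" "\<Omega> \<times> \<Omega> \<in> sets lebesgue"
    using \<Omega> open_Times[OF \<Omega> \<Omega>] by auto
  obtain K1 where K1: "compact K1" "K1 \<subseteq> \<Omega>" "\<And>x. x \<notin> K1 \<Longrightarrow> u x = 0"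
    using test_functionsE[OF u] by metis
  obtain K2 where K2: "compact K2" "K2 \<subseteq> \<Omega>" "\<And>x. x \<notin> K2 \<Longrightarrow> v x = 0"
    using test_functionsE[OF v] by metis
  define K where "K = {x - y | x y. x \<in> K1 \<and> y \<in> K2}"
  have K: "compact K" "K \<subseteq> U" "\<And>x y. x \<in> K1 \<Longrightarrow> y \<in> K2 \<Longrightarrow> x - y \<in> K"
    unfolding K_def U_def using compact_differences[OF K1(1) K2(1)] K1(2) K2(2) by auto
  have loc: "\<alpha> locally_integrable_on U" "L locally_integrable_on U"
    using lap by (auto simp: has_weak_laplacian_def U_def)
  obtain a where a: "integrable lborel a" "AE d in lborel. a d = indicator K d * \<alpha> d"
    using borel_version_on_compact[OF loc(1) K(1,2)] by metis
  obtain l where l: "integrable lborel l" "AE d in lborel. l d = indicator K d * L d"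
    using borel_version_on_compact[OF loc(2) K(1,2)] by metis
  have [measurable]: "a \<in> borel_measurable borel" "l \<in> borel_measurable borel"
    using borel_measurable_integrable[OF a(1)] borel_measurable_integrable[OF l(1)] by simp_all
  define w where "w = correlation u v"
  have w: "w \<in> test_functions U"
    unfolding w_def U_def by (rule correlation_test_functions[OF u v])
  have w0: "w d = 0" if "d \<notin> K" for d
    unfolding w_def by (rule correlation_outside[OF K1(3) K2(3) that[unfolded K_def]])
  let ?Du = "\<lambda>x. jacobian u (at x)" and ?Dv = "\<lambda>x. jacobian v (at x)"
  note Du = jacobian_test_function[OF u K1(1,3)]
  note Dv = jacobian_test_function[OF v K2(1,3)]
  have Dw: "correlation ?Du ?Dv d = - laplacian w d" for d
    unfolding w_def by (rule correlation_jacobian[OF u v])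
  have Dw0: "laplacian w d = 0" if "d \<notin> K" for d
    using correlation_outside[OF Du(2) Dv(2) that[unfolded K_def]] Dw[of d] by simp
  have [measurable]: "u \<in> borel_measurable borel" "v \<in> borel_measurable borel"
    "?Du \<in> borel_measurable borel" "?Dv \<in> borel_measurable borel" "w \<in> borel_measurable borel"
    using test_functions_continuous[OF u] test_functions_continuous[OF v] Du(1) Dv(1)
      test_functions_continuous[OF w] by (simp_all add: borel_measurable_continuous_onI)
  have lapw_cont: "continuous_on UNIV (laplacian w)"
  proof -
    have "partial_deriv b (partial_deriv b w) \<in> test_functions U" for b
      unfolding partial_deriv_def using test_functions_deriv[OF test_functions_deriv[OF w]] by blast
    then show ?thesis
      unfolding laplacian_def by (intro continuous_on_sum test_functions_continuous)
  qed
  have [measurable]: "laplacian w \<in> borel_measurable borel"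
    using lapw_cont by (rule borel_measurable_continuous_onI)
  have inner_int: "(LINT y|lebesgue_on \<Omega>. \<alpha> (x - y) * (?Du x \<bullet> ?Dv y)) = (LINT y|lborel. a (x - y) * (?Du x \<bullet> ?Dv y))" for x
  proof -
    have "AE y in lborel. indicator \<Omega> y *\<^sub>R (\<alpha> (x - y) * (?Du x \<bullet> ?Dv y)) = a (x - y) * (?Du x \<bullet> ?Dv y)"
      using AE_lborel_reflect[OF a(2), of x]
    proof (rule eventually_mono)
      fix y assume *: "a (x - y) = indicator K (x - y) * \<alpha> (x - y)"
      show "indicator \<Omega> y *\<^sub>R (\<alpha> (x - y) * (?Du x \<bullet> ?Dv y)) = a (x - y) * (?Du x \<bullet> ?Dv y)"
      proof (cases "x \<in> K1 \<and> y \<in> K2")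
        case True
        then show ?thesis
          using K(3)[of x y] K2(2) by (auto simp: *)
      next
        case False
        then have "?Du x \<bullet> ?Dv y = 0"
          using Du(2) Dv(2) by force
        then show ?thesis by simp
      qed
    qed
    from integral_lebesgue_eq_lborel(1)[OF _ this] show ?thesis
      using \<Omega>m(1) by (simp add: integral_restrict_space)
  qed
  have outer_borel: "(\<lambda>x. LINT y|lborel. a (x - y) * (?Du x \<bullet> ?Dv y)) \<in> borel_measurable borel"
    by measurable
  have "kernel_inner \<Omega> (\<lambda>x x'. \<alpha> (x - x')) u v
      = (LINT x|lebesgue_on \<Omega>. LINT y|lborel. a (x - y) * (?Du x \<bullet> ?Dv y))"
    unfolding kernel_inner_def inner_int ..
  also have "\<dots> = (LINT x|lebesgue. indicator \<Omega> x *\<^sub>R (LINT y|lborel. a (x - y) * (?Du x \<bullet> ?Dv y)))"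
    using \<Omega>m(1) by (simp add: integral_restrict_space)
  also have "\<dots> = (LINT x|lborel. LINT y|lborel. a (x - y) * (?Du x \<bullet> ?Dv y))"
  proof (rule integral_lebesgue_eq_lborel(1)[OF outer_borel], rule AE_I2)
    fix x
    show "indicator \<Omega> x *\<^sub>R (LINT y|lborel. a (x - y) * (?Du x \<bullet> ?Dv y)) = (LINT y|lborel. a (x - y) * (?Du x \<bullet> ?Dv y))"
      using Du(2)[of x] K1(2) by (cases "x \<in> K1") auto
  qed
  also have "\<dots> = (LINT d|lborel. a d * correlation ?Du ?Dv d)"
    by (rule convolution_form(1)[OF a(1) Du(1) K1(1) Du(2) Dv(1) K2(1) Dv(2)])
  also have "\<dots> = - (LINT d|lborel. a d * laplacian w d)"
    by (simp add: Dw)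
  also have "(LINT d|lborel. a d * laplacian w d) = (LINT d|lebesgue_on U. \<alpha> d * laplacian w d)"
  proof -
    have "AE d in lborel. indicator U d *\<^sub>R (\<alpha> d * laplacian w d) = a d * laplacian w d"
      using a(2) by (rule eventually_mono) (use K(2) Dw0 in \<open>auto simp: indicator_def\<close>)
    from integral_lebesgue_eq_lborel(1)[OF _ this] show ?thesis
      using U by (simp add: integral_restrict_space)
  qed
  also have "\<dots> = (LINT d|lebesgue_on U. L d * w d)"
    using lap w by (simp add: has_weak_laplacian_def U_def)
  also have "\<dots> = (LINT d|lborel. l d * w d)"
  proof -
    have "AE d in lborel. indicator U d *\<^sub>R (L d * w d) = l d * w d"
      using l(2) by (rule eventually_mono) (use K(2) w0 in \<open>auto simp: indicator_def\<close>)
    from integral_lebesgue_eq_lborel(1)[OF _ this] show ?thesis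
      using U by (simp add: integral_restrict_space)
  qed
  also have "\<dots> = (LINT z|lborel. l (fst z - snd z) * (u (fst z) \<bullet> v (snd z)))"
    unfolding w_def
    by (rule convolution_form(2)[OF l(1) test_functions_continuous[OF u] K1(1,3)
        test_functions_continuous[OF v] K2(1,3), symmetric])
  also have "\<dots> = (LINT z|lebesgue_on (\<Omega> \<times> \<Omega>). L (fst z - snd z) * (u (fst z) \<bullet> v (snd z)))"
  proof -
    have "AE z in lborel. indicator (\<Omega> \<times> \<Omega>) z *\<^sub>R (L (fst z - snd z) * (u (fst z) \<bullet> v (snd z)))
        = l (fst z - snd z) * (u (fst z) \<bullet> v (snd z))"
      using AE_lborel_difference[OF l(2)]
    proof (rule eventually_mono)
      fix z assume *: "l (fst z - snd z) = indicator K (fst z - snd z) * L (fst z - snd z)"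
      show "indicator (\<Omega> \<times> \<Omega>) z *\<^sub>R (L (fst z - snd z) * (u (fst z) \<bullet> v (snd z)))
        = l (fst z - snd z) * (u (fst z) \<bullet> v (snd z))"
      proof (cases "fst z \<in> K1 \<and> snd z \<in> K2")
        case True
        then have "z \<in> \<Omega> \<times> \<Omega>"
          using K1(2) K2(2) by (auto simp: mem_Times_iff)
        then show ?thesis
          using True K(3)[of "fst z" "snd z"] by (simp add: *)
      next
        case False
        then have "u (fst z) \<bullet> v (snd z) = 0"
          using K1(3) K2(3) by force
        then show ?thesis by simp
      qed
    qed
    from integral_lebesgue_eq_lborel(1)[OF _ this]
    have "(LINT z|lebesgue. indicator (\<Omega> \<times> \<Omega>) z *\<^sub>R (L (fst z - snd z) * (u (fst z) \<bullet> v (snd z))))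
        = (LINT z|lborel. l (fst z - snd z) * (u (fst z) \<bullet> v (snd z)))"
      unfolding borel_prod[symmetric] by measurable
    then show ?thesis
      using \<Omega>m(2) by (simp add: integral_restrict_space)
  qed
  finally show ?thesis .
qed

section \<open>Estimates for the bilinear form of a square-integrable kernel\<close>

definition kernel_form ::
    "'a::euclidean_space set \<Rightarrow> ('a \<times> 'a \<Rightarrow> real) \<Rightarrow> ('a \<Rightarrow> 'b::euclidean_space) \<Rightarrow> real" where
  "kernel_form \<Omega> k \<phi> = (LINT z|lebesgue_on (\<Omega> \<times> \<Omega>). k z * (\<phi> (fst z) \<bullet> \<phi> (snd z)))"

lemma integral_lebesgue_on_eq_lborel:
  fixes h :: "'a::euclidean_space \<Rightarrow> real"
  assumes "h \<in> borel_measurable borel" "\<Omega> \<in> sets lebesgue" "\<And>x. x \<notin> \<Omega> \<Longrightarrow> h x = 0"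
  shows "(LINT x|lebesgue_on \<Omega>. h x) = (LINT x|lborel. h x)"
proof -
  have "(LINT x|lebesgue_on \<Omega>. h x) = (LINT x|lebesgue. indicator \<Omega> x *\<^sub>R h x)"
    using assms(2) by (simp add: integral_restrict_space)
  also have "\<dots> = (LINT x|lebesgue. h x)"
    using assms(3) by (intro Bochner_Integration.integral_cong refl) (auto simp: indicator_def)
  also have "\<dots> = (LINT x|lborel. h x)"
    using integral_completion[of h lborel] assms(1) by simp
  finally show ?thesis .
qed

lemma integral_lborel_product:
  fixes f :: "'a::euclidean_space \<times> 'a \<Rightarrow> real"
  assumes "continuous_on UNIV f" "compact K" "\<And>z. z \<notin> K \<Longrightarrow> f z = 0"
  shows "(LINT z|lborel. f z) = (LINT x|lborel. LINT y|lborel. f (x, y))"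
  using lborel_pair.integral_fst'[of f] continuous_bounded_support_integrable[OF assms]
  by (simp add: lborel_prod)

lemma sq_norm_test_function:
  assumes "\<phi> \<in> test_functions \<Omega>" "\<Omega> \<in> sets lebesgue"
  shows "sq_norm \<Omega> \<phi> = (LINT x|lborel. (norm (\<phi> x))\<^sup>2)" "integrable lborel (\<lambda>x. (norm (\<phi> x))\<^sup>2)"
proof -
  have c: "continuous_on UNIV (\<lambda>x. (norm (\<phi> x))\<^sup>2)"
    by (intro continuous_intros test_functions_continuous[OF assms(1)])
  show "sq_norm \<Omega> \<phi> = (LINT x|lborel. (norm (\<phi> x))\<^sup>2)"
    unfolding sq_norm_def
    by (rule integral_lebesgue_on_eq_lborel[OF borel_measurable_continuous_onI[OF c] assms(2)])
      (simp add: test_functions_outside[OF assms(1)])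
  obtain K where K: "compact K" "\<And>x. x \<notin> K \<Longrightarrow> \<phi> x = 0"
    using test_functionsE[OF assms(1)] by metis
  show "integrable lborel (\<lambda>x. (norm (\<phi> x))\<^sup>2)"
    by (rule continuous_bounded_support_integrable[OF c K(1)]) (simp add: K(2))
qed

lemma test_function_pair_continuous:
  fixes \<phi> :: "'a::euclidean_space \<Rightarrow> 'b::euclidean_space"
  assumes "\<phi> \<in> test_functions \<Omega>"
  shows "continuous_on UNIV (\<lambda>z::'a \<times> 'a. \<phi> (fst z))" "continuous_on UNIV (\<lambda>z::'a \<times> 'a. \<phi> (snd z))"
  by (rule continuous_on_compose2[OF test_functions_continuous[OF assms]]; auto intro!: continuous_intros)+

text \<open>
  With \<open>t = sq_norm \<Omega> \<phi>\<close>, when positive, this gives boundedness of the form; with a large fixed \<open>t\<close> it shows that the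
  form is small on a ball when \<open>q\<close> is small in \<open>L\<^sup>2\<close>.
\<close>

lemma kernel_form_bound:
  fixes \<phi> :: "'a::euclidean_space \<Rightarrow> 'b::euclidean_space"
  assumes \<Omega>: "open \<Omega>" and q: "q \<in> L2 (\<Omega> \<times> \<Omega>)" and \<phi>: "\<phi> \<in> test_functions \<Omega>"
  shows "integrable (lebesgue_on (\<Omega> \<times> \<Omega>)) (\<lambda>z. q z * (\<phi> (fst z) \<bullet> \<phi> (snd z)))"
    "t > 0 \<Longrightarrow> \<bar>kernel_form \<Omega> q \<phi>\<bar> \<le> (t * sq_norm (\<Omega> \<times> \<Omega>) q + (sq_norm \<Omega> \<phi>)\<^sup>2 / t) / 2"
proof -
  let ?M = "lebesgue_on (\<Omega> \<times> \<Omega>)"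
  have \<Omega>m: "\<Omega> \<in> sets lebesgue" "\<Omega> \<times> \<Omega> \<in> sets lebesgue"
    using \<Omega> open_Times[OF \<Omega> \<Omega>] by auto
  define F where "F z = \<phi> (fst z) \<bullet> \<phi> (snd z)" for z
  define G where "G z = (norm (\<phi> (fst z)))\<^sup>2 * (norm (\<phi> (snd z)))\<^sup>2" for z
  obtain K where K: "compact K" "\<And>x. x \<notin> K \<Longrightarrow> \<phi> x = 0"
    using test_functionsE[OF \<phi>] by metis
  have F_cont: "continuous_on UNIV F" and G_cont: "continuous_on UNIV G"
    unfolding F_def G_def by (intro continuous_intros test_function_pair_continuous[OF \<phi>])+
  have G0: "G z = 0" if "z \<notin> K \<times> K" for z
    using that K(2) by (auto simp: G_def mem_Times_iff)
  have KK: "compact (K \<times> K)"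
    using K(1) by (intro compact_Times)
  have G_int: "integrable lborel G"
    by (rule continuous_bounded_support_integrable[OF G_cont KK G0])
  have F_sq: "(F z)\<^sup>2 \<le> G z" for z
    using power_mono[OF Cauchy_Schwarz_ineq2[of "\<phi> (fst z)" "\<phi> (snd z)"], of 2]
    by (simp add: F_def G_def power_mult_distrib)
  have "(LINT z|?M. G z) = (LINT z|lborel. G z)"
    using test_functions_outside[OF \<phi>] \<Omega>m(2)
    by (intro integral_lebesgue_on_eq_lborel borel_measurable_continuous_onI[OF G_cont])
      (auto simp: G_def mem_Times_iff)
  also have "\<dots> = (LINT x|lborel. LINT y|lborel. G (x, y))"
    by (rule integral_lborel_product[OF G_cont KK]) (rule G0)
  also have "\<dots> = (LINT x|lborel. LINT y|lborel. (norm (\<phi> x))\<^sup>2 * (norm (\<phi> y))\<^sup>2)"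
    by (simp add: G_def)
  also have "\<dots> = (sq_norm \<Omega> \<phi>)\<^sup>2"
    by (simp add: sq_norm_test_function(1)[OF \<phi> \<Omega>m(1)] power2_eq_square)
  finally have G_eq: "(LINT z|?M. G z) = (sq_norm \<Omega> \<phi>)\<^sup>2" .
  have bound: "norm (q z * F z) \<le> (t * (norm (q z))\<^sup>2 + G z / t) / 2" if "t > 0" for t z
  proof -
    have "2 * \<bar>q z * F z\<bar> \<le> t * (q z)\<^sup>2 + (F z)\<^sup>2 / t"
    proof -
      have "0 \<le> (t * \<bar>q z\<bar> - \<bar>F z\<bar>)\<^sup>2 / t"
        using that by simp
      also have "\<dots> = t * (q z)\<^sup>2 + (F z)\<^sup>2 / t - 2 * \<bar>q z * F z\<bar>"
        using that by (simp add: power2_diff power_mult_distrib abs_mult field_simps power2_eq_square)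
      finally show ?thesis by simp
    qed
    also have "\<dots> \<le> t * (q z)\<^sup>2 + G z / t"
      using F_sq[of z] that by (simp add: divide_right_mono)
    finally show ?thesis by simp
  qed
  have q': "q \<in> borel_measurable ?M" "integrable ?M (\<lambda>z. (norm (q z))\<^sup>2)"
    using q by (auto simp: L2_def)
  have G_int': "integrable ?M G"
    by (rule integrable_lebesgue_on_lborel[OF G_int \<Omega>m(2)])
  have bd_int: "integrable ?M (\<lambda>z. (t * (norm (q z))\<^sup>2 + G z / t) / 2)" for t
    using q'(2) G_int' by simp
  have F_meas: "F \<in> borel_measurable ?M"
    by (rule borel_measurable_lebesgue_on_continuous[OF F_cont])
  have int: "integrable ?M (\<lambda>z. q z * F z)"
  proof (rule Bochner_Integration.integrable_bound[OF bd_int[of 1]])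
    show "(\<lambda>z. q z * F z) \<in> borel_measurable ?M"
      using q'(1) F_meas by simp
    show "AE z in ?M. norm (q z * F z) \<le> norm ((1 * (norm (q z))\<^sup>2 + G z / 1) / 2)"
      by (intro AE_I2 order_trans[OF bound[OF zero_less_one]]) (simp only: real_norm_def abs_ge_self)
  qed
  then show "integrable ?M (\<lambda>z. q z * (\<phi> (fst z) \<bullet> \<phi> (snd z)))"
    by (simp add: F_def)
  assume t: "t > 0"
  have "\<bar>kernel_form \<Omega> q \<phi>\<bar> = norm (LINT z|?M. q z * F z)"
    by (simp add: kernel_form_def F_def)
  also have "\<dots> \<le> (LINT z|?M. norm (q z * F z))"
    by (rule integral_norm_bound)
  also have "\<dots> \<le> (LINT z|?M. (t * (norm (q z))\<^sup>2 + G z / t) / 2)"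
    by (rule integral_mono[OF integrable_norm[OF int] bd_int bound[OF t]])
  also have "\<dots> = (t * sq_norm (\<Omega> \<times> \<Omega>) q + (sq_norm \<Omega> \<phi>)\<^sup>2 / t) / 2"
    using q'(2) G_int' by (simp add: sq_norm_def G_eq)
  finally show "\<bar>kernel_form \<Omega> q \<phi>\<bar> \<le> (t * sq_norm (\<Omega> \<times> \<Omega>) q + (sq_norm \<Omega> \<phi>)\<^sup>2 / t) / 2" .
qed

definition moment :: "('a::euclidean_space \<Rightarrow> real) \<Rightarrow> ('a \<Rightarrow> 'b::euclidean_space) \<Rightarrow> 'b" where
  "moment a \<phi> = (LINT x|lborel. a x *\<^sub>R \<phi> x)"

lemma moment_integrable:
  assumes "continuous_on UNIV a" "\<phi> \<in> test_functions \<Omega>"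
  shows "integrable lborel (\<lambda>x. a x *\<^sub>R \<phi> x)"
proof -
  obtain K where K: "compact K" "\<And>x. x \<notin> K \<Longrightarrow> \<phi> x = 0"
    using test_functionsE[OF assms(2)] by metis
  show ?thesis
    by (rule continuous_bounded_support_integrable[OF
          continuous_on_scaleR[OF assms(1) test_functions_continuous[OF assms(2)]] K(1)])
      (simp add: K(2))
qed

lemma moment_diff:
  assumes "continuous_on UNIV a" "\<phi> \<in> test_functions \<Omega>" "\<psi> \<in> test_functions \<Omega>"
  shows "moment a (\<lambda>x. \<phi> x - \<psi> x) = moment a \<phi> - moment a \<psi>"
  using moment_integrable[OF assms(1,2)] moment_integrable[OF assms(1,3)]
  by (simp add: moment_def scaleR_diff_right)

text \<open>
  On \<open>\<Omega>\<close> the weight \<open>a\<close> is bounded, and \<open>|\<phi>| \<le> 1 + |\<phi>|\<^sup>2\<close> is integrable over a bounded set.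
\<close>

lemma moment_bounded:
  fixes \<Omega> :: "'a::euclidean_space set"
  assumes "continuous_on UNIV a" "open \<Omega>" "bounded \<Omega>"
  obtains C where "C \<ge> 0"
    "\<And>\<phi> :: 'a \<Rightarrow> 'b::euclidean_space. \<phi> \<in> test_functions \<Omega> \<Longrightarrow> sq_norm \<Omega> \<phi> \<le> R \<Longrightarrow> norm (moment a \<phi>) \<le> C"
proof -
  have \<Omega>m: "\<Omega> \<in> sets lebesgue" using assms by auto
  have ind: "integrable lborel (indicator \<Omega> :: 'a \<Rightarrow> real)"
    using assms(2,3) emeasure_bounded_finite[OF assms(3)] by (simp add: integrable_indicator_iff)
  have "bounded (a ` closure \<Omega>)"
    using assms by (meson compact_closure compact_continuous_image compact_imp_bounded continuous_on_subset subset_UNIV)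
  then obtain c0 where "\<And>x. x \<in> closure \<Omega> \<Longrightarrow> norm (a x) \<le> c0"
    by (auto simp: bounded_iff)
  then have c0: "\<bar>a x\<bar> \<le> max c0 0" if "x \<in> \<Omega>" for x
    using that closure_subset[of \<Omega>] by fastforce
  define c where "c = max c0 0"
  have c: "c \<ge> 0" "\<And>x. x \<in> \<Omega> \<Longrightarrow> \<bar>a x\<bar> \<le> c"
    using c0 by (auto simp: c_def)
  define m where "m = (LINT x|lborel. indicator \<Omega> x :: real)"
  have "norm (moment a \<phi>) \<le> c * (m + R)" if \<phi>: "\<phi> \<in> test_functions \<Omega>" "sq_norm \<Omega> \<phi> \<le> R"
    for \<phi> :: "'a \<Rightarrow> 'b"
  proof -
    note sq = sq_norm_test_function[OF \<phi>(1) \<Omega>m]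
    have "norm (moment a \<phi>) \<le> (LINT x|lborel. norm (a x *\<^sub>R \<phi> x))"
      unfolding moment_def by (rule integral_norm_bound)
    also have "\<dots> \<le> (LINT x|lborel. c * (indicator \<Omega> x + (norm (\<phi> x))\<^sup>2))"
    proof (rule integral_mono)
      show "integrable lborel (\<lambda>x. norm (a x *\<^sub>R \<phi> x))"
        by (rule integrable_norm[OF moment_integrable[OF assms(1) \<phi>(1)]])
      show "integrable lborel (\<lambda>x. c * (indicator \<Omega> x + (norm (\<phi> x))\<^sup>2))"
        using ind sq(2) by simp
      fix x
      show "norm (a x *\<^sub>R \<phi> x) \<le> c * (indicator \<Omega> x + (norm (\<phi> x))\<^sup>2)"
      proof (cases "x \<in> \<Omega>")
        case True
        have "norm (\<phi> x) \<le> 1 + (norm (\<phi> x))\<^sup>2"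
          using sum_squares_bound[of "norm (\<phi> x)" 1] norm_ge_zero[of "\<phi> x"]
          unfolding power_one by linarith
        then have "\<bar>a x\<bar> * norm (\<phi> x) \<le> c * (1 + (norm (\<phi> x))\<^sup>2)"
          using c True by (intro mult_mono) auto
        then show ?thesis
          using True by simp
      next
        case False
        then show ?thesis
          using c(1) by (simp add: test_functions_outside[OF \<phi>(1)])
      qed
    qed
    also have "\<dots> = c * (m + sq_norm \<Omega> \<phi>)"
      using ind sq by (simp add: m_def)
    also have "\<dots> \<le> c * (m + R)"
      using \<phi>(2) c(1) by (intro mult_left_mono) auto
    finally show ?thesis .
  qed
  then show ?thesis
    using that[of "max 0 (c * (m + R))"] by (simp add: le_max_iff_disj)
qed

text \<open>
  On a kernel of finite rank the double integral factorizes.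
\<close>

lemma kernel_form_tensor_sum:
  fixes \<phi> :: "'a::euclidean_space \<Rightarrow> 'b::euclidean_space"
  assumes \<Omega>: "open \<Omega>" and \<phi>: "\<phi> \<in> test_functions \<Omega>" and ps: "continuous_tensor ps"
  shows "integrable (lebesgue_on (\<Omega> \<times> \<Omega>)) (\<lambda>z. tensor_sum ps (fst z) (snd z) * (\<phi> (fst z) \<bullet> \<phi> (snd z)))"
    "kernel_form \<Omega> (\<lambda>z. tensor_sum ps (fst z) (snd z)) \<phi> = (\<Sum>(a, b)\<leftarrow>ps. moment a \<phi> \<bullet> moment b \<phi>)"
  using ps
proof (induction ps)
  case Nil
  {
    case 1 show ?case by simp
  next
    case 2 show ?case by (simp add: kernel_form_def)
  }
next
  case (Cons p ps)
  obtain a b where p: "p = (a, b)" by fastforce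
  let ?M = "lebesgue_on (\<Omega> \<times> \<Omega>)"
  have \<Omega>m: "\<Omega> \<times> \<Omega> \<in> sets lebesgue"
    using open_Times[OF \<Omega> \<Omega>] by auto
  obtain K where K: "compact K" "\<And>x. x \<notin> K \<Longrightarrow> \<phi> x = 0"
    using test_functionsE[OF \<phi>] by metis
  define H where "H z = a (fst z) * b (snd z) * (\<phi> (fst z) \<bullet> \<phi> (snd z))" for z
  have H: "integrable ?M H" "(LINT z|?M. H z) = moment a \<phi> \<bullet> moment b \<phi>"
    if ab: "continuous_on UNIV a" "continuous_on UNIV b"
  proof -
    have cont: "continuous_on UNIV H"
      unfolding H_def
      by (intro continuous_on_mult continuous_on_inner test_function_pair_continuous[OF \<phi>]
          continuous_on_compose2[OF ab(1) continuous_on_fst[OF continuous_on_id]]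
          continuous_on_compose2[OF ab(2) continuous_on_snd[OF continuous_on_id]]) auto
    have KK: "compact (K \<times> K)"
      using K(1) by (intro compact_Times)
    have H0: "H z = 0" if "z \<notin> K \<times> K" for z
      using that K(2) by (auto simp: H_def mem_Times_iff)
    show "integrable ?M H"
      by (rule integrable_lebesgue_on_lborel[OF continuous_bounded_support_integrable[OF cont KK H0] \<Omega>m])
    note ia = moment_integrable[OF ab(1) \<phi>] and ib = moment_integrable[OF ab(2) \<phi>]
    have "(LINT z|?M. H z) = (LINT z|lborel. H z)"
      using test_functions_outside[OF \<phi>] \<Omega>m
      by (intro integral_lebesgue_on_eq_lborel borel_measurable_continuous_onI[OF cont])
        (auto simp: H_def mem_Times_iff)
    also have "\<dots> = (LINT x|lborel. LINT y|lborel. H (x, y))"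
      by (rule integral_lborel_product[OF cont KK]) (rule H0)
    also have "\<dots> = (LINT x|lborel. LINT y|lborel. (a x *\<^sub>R \<phi> x) \<bullet> (b y *\<^sub>R \<phi> y))"
      by (simp add: H_def mult_ac)
    also have "\<dots> = (LINT x|lborel. (a x *\<^sub>R \<phi> x) \<bullet> moment b \<phi>)"
      unfolding moment_def by (intro Bochner_Integration.integral_cong refl integral_inner_right ib)
    also have "\<dots> = moment a \<phi> \<bullet> moment b \<phi>"
      unfolding moment_def[of a] by (intro integral_inner_left ia)
    finally show "(LINT z|?M. H z) = moment a \<phi> \<bullet> moment b \<phi>" .
  qed
  have eq: "(\<lambda>z. tensor_sum (p # ps) (fst z) (snd z) * (\<phi> (fst z) \<bullet> \<phi> (snd z)))
      = (\<lambda>z. H z + tensor_sum ps (fst z) (snd z) * (\<phi> (fst z) \<bullet> \<phi> (snd z)))"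
    by (simp add: p H_def algebra_simps)
  {
    case 1
    then show ?case
      unfolding eq using Cons.IH(1) H(1) p by (intro Bochner_Integration.integrable_add) auto
  next
    case 2
    then show ?case
      using Cons.IH H p unfolding kernel_form_def eq
      by (subst Bochner_Integration.integral_add) auto
  }
qed

lemma kernel_form_tensor_sum_bound:
  fixes \<Omega> :: "'a::euclidean_space set"
  assumes \<Omega>: "open \<Omega>" "bounded \<Omega>" and ps: "continuous_tensor ps"
  obtains C where "C \<ge> 0"
    "\<And>\<phi> :: 'a \<Rightarrow> 'b::euclidean_space. \<phi> \<in> test_functions \<Omega> \<Longrightarrow> sq_norm \<Omega> \<phi> \<le> R \<Longrightarrow>
       \<bar>kernel_form \<Omega> (\<lambda>z. tensor_sum ps (fst z) (snd z)) \<phi>\<bar> \<le> C * (\<Sum>(a, b)\<leftarrow>ps. norm (moment b \<phi>))"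
proof -
  have "\<exists>C\<ge>0. \<forall>\<phi> :: 'a \<Rightarrow> 'b. \<phi> \<in> test_functions \<Omega> \<longrightarrow> sq_norm \<Omega> \<phi> \<le> R \<longrightarrow>
       \<bar>\<Sum>(a, b)\<leftarrow>ps. moment a \<phi> \<bullet> moment b \<phi>\<bar> \<le> C * (\<Sum>(a, b)\<leftarrow>ps. norm (moment b \<phi>))"
    using ps
  proof (induction ps)
    case (Cons p ps)
    obtain a b where p: "p = (a, b)" by fastforce
    obtain C where C: "C \<ge> 0" "\<And>\<phi> :: 'a \<Rightarrow> 'b. \<phi> \<in> test_functions \<Omega> \<Longrightarrow> sq_norm \<Omega> \<phi> \<le> R \<Longrightarrow>
       \<bar>\<Sum>(a, b)\<leftarrow>ps. moment a \<phi> \<bullet> moment b \<phi>\<bar> \<le> C * (\<Sum>(a, b)\<leftarrow>ps. norm (moment b \<phi>))"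
      using Cons p by auto
    have "continuous_on UNIV a"
      using Cons.prems p by simp
    then obtain C' where C': "C' \<ge> 0" "\<And>\<phi> :: 'a \<Rightarrow> 'b. \<phi> \<in> test_functions \<Omega> \<Longrightarrow> sq_norm \<Omega> \<phi> \<le> R \<Longrightarrow> norm (moment a \<phi>) \<le> C'"
      using moment_bounded[OF _ \<Omega>] by metis
    show ?case
    proof (intro exI[of _ "C + C'"] conjI allI impI)
      fix \<phi> :: "'a \<Rightarrow> 'b"
      assume \<phi>: "\<phi> \<in> test_functions \<Omega>" "sq_norm \<Omega> \<phi> \<le> R"
      let ?S = "\<Sum>(a, b)\<leftarrow>ps. norm (moment b \<phi>)"
      have S: "?S \<ge> 0"
        by (intro sum_list_nonneg) auto
      have "\<bar>moment a \<phi> \<bullet> moment b \<phi>\<bar> \<le> norm (moment a \<phi>) * norm (moment b \<phi>)"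
        by (rule Cauchy_Schwarz_ineq2)
      also have "\<dots> \<le> C' * norm (moment b \<phi>)"
        using C'(2)[OF \<phi>] by (rule mult_right_mono) simp
      finally have "\<bar>moment a \<phi> \<bullet> moment b \<phi> + (\<Sum>(a, b)\<leftarrow>ps. moment a \<phi> \<bullet> moment b \<phi>)\<bar>
          \<le> C' * norm (moment b \<phi>) + C * ?S"
        using C(2)[OF \<phi>] by linarith
      also have "\<dots> \<le> (C + C') * (norm (moment b \<phi>) + ?S)"
        using C(1) C'(1) S by (simp add: algebra_simps)
      finally show "\<bar>\<Sum>(a, b)\<leftarrow>p # ps. moment a \<phi> \<bullet> moment b \<phi>\<bar>
          \<le> (C + C') * (\<Sum>(a, b)\<leftarrow>p # ps. norm (moment b \<phi>))"
        by (simp add: p)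
    qed (use C C' in simp)
  qed auto
  then obtain C where C: "C \<ge> 0" "\<And>\<phi> :: 'a \<Rightarrow> 'b. \<phi> \<in> test_functions \<Omega> \<Longrightarrow> sq_norm \<Omega> \<phi> \<le> R \<Longrightarrow>
       \<bar>\<Sum>(a, b)\<leftarrow>ps. moment a \<phi> \<bullet> moment b \<phi>\<bar> \<le> C * (\<Sum>(a, b)\<leftarrow>ps. norm (moment b \<phi>))"
    by auto
  show ?thesis
  proof (rule that[OF C(1)])
    fix \<phi> :: "'a \<Rightarrow> 'b"
    assume \<phi>: "\<phi> \<in> test_functions \<Omega>" "sq_norm \<Omega> \<phi> \<le> R"
    show "\<bar>kernel_form \<Omega> (\<lambda>z. tensor_sum ps (fst z) (snd z)) \<phi>\<bar> \<le> C * (\<Sum>(a, b)\<leftarrow>ps. norm (moment b \<phi>))"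
      using C(2)[OF \<phi>] unfolding kernel_form_tensor_sum(2)[OF \<Omega>(1) \<phi>(1) ps] .
  qed
qed

text \<open>
  Finitely many maps with bounded images in a Euclidean space are jointly a map with bounded, hence
  totally bounded, image. The induction avoids the product space: \<open>S\<close> is cut into finitely many pieces
  on which the first map is nearly constant, and each piece is treated separately.
\<close>

lemma finite_net_of_bounded_maps:
  fixes fs :: "('x \<Rightarrow> 'b::euclidean_space) list"
  assumes "\<And>f. f \<in> set fs \<Longrightarrow> bounded (f ` S)" "\<delta> > 0"
  shows "\<exists>F. finite F \<and> F \<subseteq> S \<and> (\<forall>x\<in>S. \<exists>y\<in>F. \<forall>f\<in>set fs. dist (f x) (f y) < \<delta>)"
  using assms(1)
proof (induction fs arbitrary: S)
  case Nil
  show ?case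
  proof (cases "S = {}")
    case False
    then obtain s where "s \<in> S" by auto
    then show ?thesis by (intro exI[of _ "{s}"]) auto
  qed auto
next
  case (Cons f fs)
  have "compact (closure (f ` S))"
    using Cons.prems by simp
  then obtain Z where Z: "finite Z" "closure (f ` S) \<subseteq> (\<Union>z\<in>Z. ball z (\<delta> / 2))"
    using assms(2) by (metis compact_eq_totally_bounded half_gt_zero)
  define P where "P z = {x \<in> S. f x \<in> ball z (\<delta> / 2)}" for z
  have "\<exists>F. finite F \<and> F \<subseteq> P z \<and> (\<forall>x\<in>P z. \<exists>y\<in>F. \<forall>g\<in>set fs. dist (g x) (g y) < \<delta>)" for z
  proof (rule Cons.IH)
    fix g assume "g \<in> set fs"
    then have "bounded (g ` S)"
      using Cons.prems by simp
    then show "bounded (g ` P z)"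
      by (rule bounded_subset) (auto simp: P_def)
  qed
  then obtain F where F: "\<And>z. finite (F z)" "\<And>z. F z \<subseteq> P z"
    "\<And>z x. x \<in> P z \<Longrightarrow> \<exists>y\<in>F z. \<forall>g\<in>set fs. dist (g x) (g y) < \<delta>"
    by metis
  show ?case
  proof (intro exI[of _ "\<Union>z\<in>Z. F z"] conjI ballI)
    show "finite (\<Union>z\<in>Z. F z)"
      using Z F by auto
    show "(\<Union>z\<in>Z. F z) \<subseteq> S"
      using F(2) unfolding P_def by blast
    fix x assume x: "x \<in> S"
    then have "f x \<in> closure (f ` S)"
      using closure_subset[of "f ` S"] by auto
    then obtain z where z: "z \<in> Z" "f x \<in> ball z (\<delta> / 2)"
      using Z(2) by auto
    then have "x \<in> P z"
      using x by (simp add: P_def)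
    then obtain y where y: "y \<in> F z" "\<forall>g\<in>set fs. dist (g x) (g y) < \<delta>"
      using F(3)[of x z] by blast
    then have "f y \<in> ball z (\<delta> / 2)"
      using F(2)[of z] by (auto simp: P_def)
    then have "dist (f x) (f y) < \<delta>"
      using z(2) dist_triangle_half_r[of z "f x" \<delta> "f y"] by (simp add: dist_commute)
    then show "\<exists>y\<in>\<Union>z\<in>Z. F z. \<forall>g\<in>set (f # fs). dist (g x) (g y) < \<delta>"
      using y z(1) by auto
  qed
qed

section \<open>Compactness\<close>

text \<open>
  On a ball of \<open>L\<^sup>2\<close> the form is below \<open>e\<close> wherever finitely many moments are small: the kernel is of
  finite rank up to an error that contributes at most \<open>3e/4\<close> on the ball.
\<close>

lemma kernel_form_small:
  fixes \<Omega> :: "'a::euclidean_space set"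
  assumes \<Omega>: "open \<Omega>" "bounded \<Omega>" and k: "k \<in> L2 (\<Omega> \<times> \<Omega>)" and "e > 0"
  shows "\<exists>\<delta>>0. \<exists>bs. (\<forall>b\<in>set bs. continuous_on UNIV b) \<and>
    (\<forall>\<phi> :: 'a \<Rightarrow> 'b::euclidean_space. \<phi> \<in> test_functions \<Omega> \<longrightarrow> sq_norm \<Omega> \<phi> \<le> R \<longrightarrow>
       (\<forall>b\<in>set bs. norm (moment b \<phi>) < \<delta>) \<longrightarrow> \<bar>kernel_form \<Omega> k \<phi>\<bar> < e)"
proof -
  \<comment> \<open>Chosen so that the term \<open>(sq_norm \<Omega> \<phi>)\<^sup>2 / t\<close> of \<open>kernel_form_bound\<close> is at most \<open>e\<close> on the ball.\<close>
  define t where "t = (R\<^sup>2 + 1) / e"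
  have t: "t > 0"
    using \<open>e > 0\<close> by (simp add: t_def add_nonneg_pos)
  obtain ps where ps: "continuous_tensor ps"
    "(\<lambda>z. k z - tensor_sum ps (fst z) (snd z)) \<in> L2 (\<Omega> \<times> \<Omega>)"
    "sq_norm (\<Omega> \<times> \<Omega>) (\<lambda>z. k z - tensor_sum ps (fst z) (snd z)) < e / (2 * t)"
    using L2_kernel_finite_rank_approximation[OF \<Omega> k, of "e / (2 * t)"] t \<open>e > 0\<close> by auto
  define q where "q z = k z - tensor_sum ps (fst z) (snd z)" for z
  obtain C where C: "C \<ge> 0"
    "\<And>\<phi> :: 'a \<Rightarrow> 'b. \<phi> \<in> test_functions \<Omega> \<Longrightarrow> sq_norm \<Omega> \<phi> \<le> R \<Longrightarrow>
       \<bar>kernel_form \<Omega> (\<lambda>z. tensor_sum ps (fst z) (snd z)) \<phi>\<bar> \<le> C * (\<Sum>(a, b)\<leftarrow>ps. norm (moment b \<phi>))"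
    by (rule kernel_form_tensor_sum_bound[OF \<Omega> ps(1), where R = R]) blast
  define C' where "C' = C + 1"
  define N where "N = real (length ps) + 1"
  have C': "C' > 0" "C \<le> C'" and N: "N > 0" "real (length ps) \<le> N"
    using C(1) by (simp_all add: C'_def N_def)
  define \<delta> where "\<delta> = e / (4 * C' * N)"
  have \<delta>: "\<delta> > 0"
    using \<open>e > 0\<close> C'(1) N(1) by (simp add: \<delta>_def)
  show ?thesis
  proof (intro exI[of _ \<delta>] conjI exI[of _ "map snd ps"] ballI allI impI)
    show "\<delta> > 0" by (rule \<delta>)
    show "continuous_on UNIV b" if "b \<in> set (map snd ps)" for b
      using ps(1) that by (auto simp: continuous_tensor_def)
    fix \<phi> :: "'a \<Rightarrow> 'b"
    assume \<phi>: "\<phi> \<in> test_functions \<Omega>" "sq_norm \<Omega> \<phi> \<le> R"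
      and small: "\<forall>b\<in>set (map snd ps). norm (moment b \<phi>) < \<delta>"
    have q_L2: "q \<in> L2 (\<Omega> \<times> \<Omega>)"
      using ps(2) by (simp add: q_def[abs_def])
    have "kernel_form \<Omega> k \<phi> = kernel_form \<Omega> q \<phi> + kernel_form \<Omega> (\<lambda>z. tensor_sum ps (fst z) (snd z)) \<phi>"
      using Bochner_Integration.integral_add[OF kernel_form_bound(1)[OF \<Omega>(1) q_L2 \<phi>(1)]
          kernel_form_tensor_sum(1)[OF \<Omega>(1) \<phi>(1) ps(1)]]
      by (simp add: kernel_form_def q_def algebra_simps)
    moreover have "\<bar>kernel_form \<Omega> q \<phi>\<bar> < 3 * e / 4"
    proof -
      have "\<bar>kernel_form \<Omega> q \<phi>\<bar> \<le> (t * sq_norm (\<Omega> \<times> \<Omega>) q + (sq_norm \<Omega> \<phi>)\<^sup>2 / t) / 2"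
        by (rule kernel_form_bound(2)[OF \<Omega>(1) q_L2 \<phi>(1) t])
      moreover have "t * sq_norm (\<Omega> \<times> \<Omega>) q < e / 2"
        using ps(3) t by (simp add: q_def[abs_def] field_simps)
      moreover have "(sq_norm \<Omega> \<phi>)\<^sup>2 / t \<le> e"
      proof -
        have "(sq_norm \<Omega> \<phi>)\<^sup>2 \<le> R\<^sup>2"
          using \<phi>(2) sq_norm_nonneg by (rule power_mono)
        also have "\<dots> \<le> e * t"
          using \<open>e > 0\<close> by (simp add: t_def)
        finally show ?thesis
          using t by (simp add: divide_le_eq)
      qed
      moreover have "x < 3 * e / 4" if "x \<le> (a + b) / 2" "a < e / 2" "b \<le> e" for x a b :: real
        using that by simp
      ultimately show ?thesis by blast
    qed
    moreover have "\<bar>kernel_form \<Omega> (\<lambda>z. tensor_sum ps (fst z) (snd z)) \<phi>\<bar> \<le> e / 4"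
    proof -
      have "(\<Sum>(a, b)\<leftarrow>ps. norm (moment b \<phi>)) \<le> (\<Sum>p\<leftarrow>ps. \<delta>)"
        using small by (intro sum_list_mono) (force intro: less_imp_le)
      also have "\<dots> = real (length ps) * \<delta>"
        by (simp add: sum_list_triv)
      finally have "C * (\<Sum>(a, b)\<leftarrow>ps. norm (moment b \<phi>)) \<le> C * (real (length ps) * \<delta>)"
        using C(1) by (rule mult_left_mono)
      also have "\<dots> \<le> C' * (N * \<delta>)"
        using C(1) C' N \<delta> by (intro mult_mono) auto
      also have "\<dots> = e / 4"
        using C'(1) N(1) by (simp add: \<delta>_def)
      finally show ?thesis
        using C(2)[OF \<phi>] by linarith
    qed
    ultimately show "\<bar>kernel_form \<Omega> k \<phi>\<bar> < e" by linarith
  qed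
qed

lemma test_functions_diff:
  assumes "f \<in> test_functions \<Omega>" "g \<in> test_functions \<Omega>"
  shows "(\<lambda>x. f x - g x) \<in> test_functions \<Omega>"
  using test_functions_add[OF assms(1) test_functions_bounded_linear[OF bounded_linear_minus[OF bounded_linear_ident] assms(2)]]
  by simp

text \<open>
  What makes \<open>J\<close> compact is its linearity together with the formula for the norm through a
  square-integrable kernel; the kernel need not come from a Laplacian.
\<close>

locale L2_kernel_energy =
  fixes \<Omega> :: "'a::euclidean_space set"
    and k :: "'a \<times> 'a \<Rightarrow> real"
    and J :: "('a \<Rightarrow> 'b::euclidean_space) \<Rightarrow> 'h::{real_inner, complete_space}"
  assumes open_\<Omega>: "open \<Omega>" and bounded_\<Omega>: "bounded \<Omega>"
    and k_L2: "k \<in> L2 (\<Omega> \<times> \<Omega>)"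
    and J_add: "\<And>u v. u \<in> test_functions \<Omega> \<Longrightarrow> v \<in> test_functions \<Omega> \<Longrightarrow> J (\<lambda>x. u x + v x) = J u + J v"
    and J_scaleR: "\<And>c u. u \<in> test_functions \<Omega> \<Longrightarrow> J (\<lambda>x. c *\<^sub>R u x) = c *\<^sub>R J u"
    and J_norm: "\<And>u. u \<in> test_functions \<Omega> \<Longrightarrow> (norm (J u))\<^sup>2 = kernel_form \<Omega> k u"
begin

lemma \<Omega>_sets: "\<Omega> \<in> sets lebesgue"
  using open_\<Omega> by auto

lemma test_L2: "\<phi> \<in> test_functions \<Omega> \<Longrightarrow> \<phi> \<in> L2 \<Omega>" for \<phi> :: "'a \<Rightarrow> 'b"
  by (rule test_functions_L2[OF _ \<Omega>_sets])

lemma J_diff: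
  assumes "u \<in> test_functions \<Omega>" "v \<in> test_functions \<Omega>"
  shows "J (\<lambda>x. u x - v x) = J u - J v"
proof -
  have "(\<lambda>x. (-1) *\<^sub>R v x) \<in> test_functions \<Omega>"
    by (rule test_functions_bounded_linear[OF bounded_linear_scaleR_right assms(2)])
  from J_add[OF assms(1) this] J_scaleR[OF assms(2), of "-1"] show ?thesis
    by simp
qed

lemma J_bounded: "\<exists>M\<ge>0. \<forall>u\<in>test_functions \<Omega>. (norm (J u))\<^sup>2 \<le> M * sq_norm \<Omega> u"
proof -
  define Q where "Q = sq_norm (\<Omega> \<times> \<Omega>) k"
  have Q: "Q \<ge> 0"
    by (simp add: Q_def sq_norm_nonneg)
  have "(norm (J u))\<^sup>2 \<le> (Q + 1) * sq_norm \<Omega> u" if u: "u \<in> test_functions \<Omega>" for u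
  proof -
    define s where "s = sq_norm \<Omega> u"
    have bound: "(norm (J u))\<^sup>2 \<le> (t * Q + s\<^sup>2 / t) / 2" if "t > 0" for t
      using kernel_form_bound(2)[OF open_\<Omega> k_L2 u that] J_norm[OF u] by (simp add: Q_def s_def)
    show ?thesis
    proof (cases "s = 0")
      case True
      have "(norm (J u))\<^sup>2 \<le> 0 + e" if "e > 0" for e
      proof -
        have "e / (Q + 1) > 0"
          using that Q by simp
        from bound[OF this] have "(norm (J u))\<^sup>2 \<le> e / (Q + 1) * Q / 2"
          by (simp add: True)
        also have "\<dots> \<le> e"
          using that Q by (simp add: divide_simps algebra_simps)
        finally show ?thesis by simp
      qed
      then have "(norm (J u))\<^sup>2 \<le> 0"
        by (rule field_le_epsilon)
      then show ?thesis
        using True by (simp add: s_def)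
    next
      case False
      then have "s > 0"
        using sq_norm_nonneg[of \<Omega> u] by (simp add: s_def)
      from bound[OF this] have "(norm (J u))\<^sup>2 \<le> s * (Q + 1) / 2"
        using \<open>s > 0\<close> by (simp add: power2_eq_square algebra_simps)
      also have "\<dots> \<le> (Q + 1) * s"
        using \<open>s > 0\<close> Q by simp
      finally show ?thesis
        by (simp add: s_def)
    qed
  qed
  then show ?thesis
    using Q by (intro exI[of _ "Q + 1"]) simp
qed

text \<open>
  A finite net for the moments is a finite net for \<open>J\<close>, because \<open>\<parallel>J \<phi> - J \<psi>\<parallel>\<^sup>2\<close> is the form evaluated
  at \<open>\<phi> - \<psi>\<close>. The squared norm of such a difference is at most \<open>4 R\<close>.
\<close>

lemma J_totally_bounded:
  assumes "e > 0"
  obtains F where "finite F" "F \<subseteq> {\<phi> \<in> test_functions \<Omega>. sq_norm \<Omega> \<phi> \<le> R}"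
    "\<And>\<phi>. \<phi> \<in> test_functions \<Omega> \<Longrightarrow> sq_norm \<Omega> \<phi> \<le> R \<Longrightarrow> \<exists>\<psi>\<in>F. dist (J \<phi>) (J \<psi>) < e"
proof -
  let ?S = "{\<phi> \<in> test_functions \<Omega>. sq_norm \<Omega> \<phi> \<le> R} :: ('a \<Rightarrow> 'b) set"
  have "e\<^sup>2 > 0"
    using assms by simp
  from kernel_form_small[OF open_\<Omega> bounded_\<Omega> k_L2 this, where R = "4 * R" and ?'b = 'b]
  obtain bs :: "('a \<Rightarrow> real) list" and \<delta> :: real where \<delta>: "\<delta> > 0"
    and bs: "\<And>b. b \<in> set bs \<Longrightarrow> continuous_on UNIV b"
    and small: "\<And>\<phi> :: 'a \<Rightarrow> 'b. \<phi> \<in> test_functions \<Omega> \<Longrightarrow> sq_norm \<Omega> \<phi> \<le> 4 * R \<Longrightarrow>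
         \<forall>b\<in>set bs. norm (moment b \<phi>) < \<delta> \<Longrightarrow> \<bar>kernel_form \<Omega> k \<phi>\<bar> < e\<^sup>2"
    by auto
  have bdd: "bounded (f ` ?S)" if f: "f \<in> set (map moment bs)" for f
  proof -
    obtain b where b: "b \<in> set bs" "f = moment b"
      using f by auto
    show ?thesis
      by (rule moment_bounded[OF bs[OF b(1)] open_\<Omega> bounded_\<Omega>, where R = R and ?'b = 'b])
        (auto simp: bounded_iff b(2))
  qed
  from finite_net_of_bounded_maps[OF bdd \<delta>]
  obtain F where F: "finite F" "F \<subseteq> ?S"
    "\<And>\<phi>. \<phi> \<in> ?S \<Longrightarrow> \<exists>\<psi>\<in>F. \<forall>f\<in>set (map moment bs). dist (f \<phi>) (f \<psi>) < \<delta>"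
    by meson
  show ?thesis
  proof (rule that[OF F(1,2)])
    fix \<phi> :: "'a \<Rightarrow> 'b"
    assume \<phi>: "\<phi> \<in> test_functions \<Omega>" "sq_norm \<Omega> \<phi> \<le> R"
    then obtain \<psi> where \<psi>: "\<psi> \<in> F" "\<forall>f\<in>set (map moment bs). dist (f \<phi>) (f \<psi>) < \<delta>"
      using F(3)[of \<phi>] by auto
    then have \<psi>': "\<psi> \<in> test_functions \<Omega>" "sq_norm \<Omega> \<psi> \<le> R"
      using F(2) by auto
    have diff: "(\<lambda>x. \<phi> x - \<psi> x) \<in> test_functions \<Omega>"
      by (rule test_functions_diff[OF \<phi>(1) \<psi>'(1)])
    have "sq_norm \<Omega> (\<lambda>x. \<phi> x - \<psi> x) \<le> 4 * R"
      using L2_diff(2)[OF test_L2[OF \<phi>(1)] test_L2[OF \<psi>'(1)]] \<phi>(2) \<psi>'(2) by linarith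
    then have "\<bar>kernel_form \<Omega> k (\<lambda>x. \<phi> x - \<psi> x)\<bar> < e\<^sup>2"
    proof (rule small[OF diff], intro ballI)
      fix b assume "b \<in> set bs"
      then show "norm (moment b (\<lambda>x. \<phi> x - \<psi> x)) < \<delta>"
        using \<psi>(2) by (simp add: moment_diff[OF bs \<phi>(1) \<psi>'(1)] dist_norm)
    qed
    then have "(norm (J \<phi> - J \<psi>))\<^sup>2 < e\<^sup>2"
      using J_norm[OF diff] by (simp add: J_diff[OF \<phi>(1) \<psi>'(1)])
    then have "dist (J \<phi>) (J \<psi>) < e"
      using assms by (simp add: dist_norm power2_less_imp_less)
    then show "\<exists>\<psi>\<in>F. dist (J \<phi>) (J \<psi>) < e"
      using \<psi>(1) by blast
  qed
qed

lemma compact_closure_image_J: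
  "compact (closure (J ` {\<phi> \<in> test_functions \<Omega>. sq_norm \<Omega> \<phi> \<le> R}))" (is "compact (closure (J ` ?S))")
  unfolding compact_eq_totally_bounded
proof (intro conjI allI impI)
  show "complete (closure (J ` ?S))"
    by (simp add: complete_eq_closed)
  fix e :: real assume "e > 0"
  then have "e / 2 > 0" by simp
  then obtain F where F: "finite F"
    "\<And>\<phi>. \<phi> \<in> test_functions \<Omega> \<Longrightarrow> sq_norm \<Omega> \<phi> \<le> R \<Longrightarrow> \<exists>\<psi>\<in>F. dist (J \<phi>) (J \<psi>) < e / 2"
    using J_totally_bounded[of "e / 2" R] by metis
  have "J ` ?S \<subseteq> (\<Union>x\<in>J ` F. cball x (e / 2))"
  proof
    fix y assume "y \<in> J ` ?S"
    then obtain \<phi> where \<phi>: "y = J \<phi>" "\<phi> \<in> test_functions \<Omega>" "sq_norm \<Omega> \<phi> \<le> R"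
      by auto
    then obtain \<psi> where "\<psi> \<in> F" "dist (J \<phi>) (J \<psi>) < e / 2"
      using F(2) by blast
    then show "y \<in> (\<Union>x\<in>J ` F. cball x (e / 2))"
      using \<phi>(1) by (auto simp: dist_commute intro!: bexI[of _ \<psi>])
  qed
  then have "closure (J ` ?S) \<subseteq> (\<Union>x\<in>J ` F. cball x (e / 2))"
    using F(1) by (intro closure_minimal closed_UN) auto
  also have "\<dots> \<subseteq> (\<Union>x\<in>J ` F. ball x e)"
    using \<open>e > 0\<close> by fastforce
  finally show "\<exists>K. finite K \<and> closure (J ` ?S) \<subseteq> (\<Union>x\<in>K. ball x e)"
    using F(1) by blast
qed

definition approximates :: "(nat \<Rightarrow> 'a \<Rightarrow> 'b) \<Rightarrow> ('a \<Rightarrow> 'b) \<Rightarrow> bool" where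
  "approximates \<phi> f \<longleftrightarrow>
     (\<forall>j. \<phi> j \<in> test_functions \<Omega>) \<and> (\<lambda>j. sq_norm \<Omega> (\<lambda>x. f x - \<phi> j x)) \<longlonglongrightarrow> 0"

lemma approximates_exists:
  assumes "f \<in> L2 \<Omega>"
  obtains \<phi> where "approximates \<phi> f"
proof -
  have "\<exists>\<phi>\<in>test_functions \<Omega>. sq_norm \<Omega> (\<lambda>x. f x - \<phi> x) < inverse (real (Suc j))" for j
  proof -
    have "0 < inverse (real (Suc j))" by simp
    then obtain \<phi> where "\<phi> \<in> test_functions \<Omega>" "sq_norm \<Omega> (\<lambda>x. f x - \<phi> x) < inverse (real (Suc j))"
      by (rule test_functions_dense_L2[OF open_\<Omega> bounded_\<Omega> assms])
    then show ?thesis by blast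
  qed
  then obtain \<phi> where \<phi>: "\<And>j. \<phi> j \<in> test_functions \<Omega>"
    "\<And>j. sq_norm \<Omega> (\<lambda>x. f x - \<phi> j x) < inverse (real (Suc j))"
    by metis
  have "(\<lambda>j. sq_norm \<Omega> (\<lambda>x. f x - \<phi> j x)) \<longlonglongrightarrow> 0"
    by (rule tendsto_sandwich[OF always_eventually always_eventually tendsto_const LIMSEQ_inverse_real_of_nat])
      (intro allI sq_norm_nonneg less_imp_le[OF \<phi>(2)])+
  then show ?thesis
    using that \<phi>(1) by (auto simp: approximates_def)
qed

lemma sq_norm_diff_approximants:
  fixes f \<phi> \<psi> :: "'a \<Rightarrow> 'b"
  assumes "f \<in> L2 \<Omega>" "\<phi> \<in> test_functions \<Omega>" "\<psi> \<in> test_functions \<Omega>"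
  shows "sq_norm \<Omega> (\<lambda>x. \<phi> x - \<psi> x)
    \<le> 2 * sq_norm \<Omega> (\<lambda>x. f x - \<phi> x) + 2 * sq_norm \<Omega> (\<lambda>x. f x - \<psi> x)"
proof -
  have "sq_norm \<Omega> (\<lambda>x. \<phi> x - \<psi> x) = sq_norm \<Omega> (\<lambda>x. (f x - \<psi> x) - (f x - \<phi> x))"
    by simp
  also have "\<dots> \<le> 2 * sq_norm \<Omega> (\<lambda>x. f x - \<psi> x) + 2 * sq_norm \<Omega> (\<lambda>x. f x - \<phi> x)"
    by (rule L2_diff(2)[OF L2_diff(1)[OF assms(1) test_L2[OF assms(3)]] L2_diff(1)[OF assms(1) test_L2[OF assms(2)]]])
  finally show ?thesis by simp
qed

text \<open>
  This yields both the Cauchy property of \<open>J\<close> along one approximating sequence (\<open>\<psi> = \<phi>\<close>) and the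
  independence of the limit of the sequence.
\<close>

lemma approximants_J_close:
  assumes f: "f \<in> L2 \<Omega>" and \<phi>: "approximates \<phi> f" and \<psi>: "approximates \<psi> f" and "e > 0"
  shows "\<exists>N. \<forall>i\<ge>N. \<forall>j\<ge>N. dist (J (\<phi> i)) (J (\<psi> j)) < e"
proof -
  obtain M where M: "M \<ge> 0" "\<And>u. u \<in> test_functions \<Omega> \<Longrightarrow> (norm (J u))\<^sup>2 \<le> M * sq_norm \<Omega> u"
    using J_bounded by blast
  define c where "c = M + 1"
  have c: "c > 0"
    using M(1) by (simp add: c_def)
  define d where "d = e\<^sup>2 / (4 * c)"
  have d: "d > 0"
    using \<open>e > 0\<close> c by (simp add: d_def)
  have tests: "\<And>i. \<phi> i \<in> test_functions \<Omega>" "\<And>j. \<psi> j \<in> test_functions \<Omega>"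
    using \<phi> \<psi> by (auto simp: approximates_def)
  have "eventually (\<lambda>i. sq_norm \<Omega> (\<lambda>x. f x - \<phi> i x) < d) sequentially"
    "eventually (\<lambda>i. sq_norm \<Omega> (\<lambda>x. f x - \<psi> i x) < d) sequentially"
    using \<phi> \<psi> d by (auto simp: approximates_def dest: order_tendstoD(2))
  then obtain N where N: "\<And>i. i \<ge> N \<Longrightarrow> sq_norm \<Omega> (\<lambda>x. f x - \<phi> i x) < d"
    "\<And>i. i \<ge> N \<Longrightarrow> sq_norm \<Omega> (\<lambda>x. f x - \<psi> i x) < d"
    by (auto simp: eventually_sequentially dest: le_trans) (metis nat_le_linear le_trans)
  have "dist (J (\<phi> i)) (J (\<psi> j)) < e" if "i \<ge> N" "j \<ge> N" for i j
  proof -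
    have "(norm (J (\<phi> i) - J (\<psi> j)))\<^sup>2 \<le> M * sq_norm \<Omega> (\<lambda>x. \<phi> i x - \<psi> j x)"
      using M(2)[OF test_functions_diff[OF tests(1)[of i] tests(2)[of j]]] by (simp add: J_diff tests)
    also have "\<dots> \<le> M * (4 * d)"
      using sq_norm_diff_approximants[OF f tests(1)[of i] tests(2)[of j]] N(1)[OF that(1)] N(2)[OF that(2)]
      by (intro mult_left_mono M(1)) linarith
    also have "\<dots> < c * (4 * d)"
      using d by (simp add: c_def algebra_simps)
    also have "\<dots> = e\<^sup>2"
      using c by (simp add: d_def)
    finally show ?thesis
      using \<open>e > 0\<close> by (simp add: dist_norm power2_less_imp_less)
  qed
  then show ?thesis by blast
qed

definition extension :: "('a \<Rightarrow> 'b) \<Rightarrow> 'h" where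
  "extension f = lim (\<lambda>j. J ((SOME \<phi>. approximates \<phi> f) j))"

lemma extension_limit:
  assumes f: "f \<in> L2 \<Omega>" and \<phi>: "approximates \<phi> f"
  shows "(\<lambda>j. J (\<phi> j)) \<longlonglongrightarrow> extension f"
proof -
  define \<psi> where "\<psi> = (SOME \<phi>. approximates \<phi> f)"
  have \<psi>: "approximates \<psi> f"
    unfolding \<psi>_def using \<phi> by (rule someI[where P = "\<lambda>\<phi>. approximates \<phi> f"])
  have "Cauchy (\<lambda>j. J (\<psi> j))"
    unfolding Cauchy_def using approximants_J_close[OF f \<psi> \<psi>] by blast
  then have lim: "(\<lambda>j. J (\<psi> j)) \<longlonglongrightarrow> extension f"
    by (simp add: extension_def \<psi>_def[symmetric] Cauchy_convergent_iff convergent_LIMSEQ_iff)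
  have "(\<lambda>j. J (\<phi> j) - J (\<psi> j)) \<longlonglongrightarrow> 0"
    using approximants_J_close[OF f \<phi> \<psi>] by (auto simp: LIMSEQ_def dist_norm) blast
  from tendsto_add[OF this lim] show ?thesis
    by simp
qed

lemma extension_test_function:
  assumes "\<phi> \<in> test_functions \<Omega>"
  shows "extension \<phi> = J \<phi>"
proof -
  have "approximates (\<lambda>j. \<phi>) \<phi>"
    using assms by (simp add: approximates_def sq_norm_def)
  from extension_limit[OF test_L2[OF assms] this] show ?thesis
    by (simp add: LIMSEQ_const_iff)
qed

lemma extension_AE_cong:
  assumes "f \<in> L2 \<Omega>" "g \<in> L2 \<Omega>" "AE x in lebesgue_on \<Omega>. f x = g x"
  shows "extension f = extension g"
proof -
  obtain \<phi> where \<phi>: "approximates \<phi> f"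
    using approximates_exists[OF assms(1)] .
  have "sq_norm \<Omega> (\<lambda>x. f x - \<phi> j x) = sq_norm \<Omega> (\<lambda>x. g x - \<phi> j x)" for j
  proof -
    have "\<phi> j \<in> L2 \<Omega>"
      using \<phi> test_L2 by (simp add: approximates_def)
    then have "(\<lambda>x. (norm (f x - \<phi> j x))\<^sup>2) \<in> borel_measurable (lebesgue_on \<Omega>)"
      "(\<lambda>x. (norm (g x - \<phi> j x))\<^sup>2) \<in> borel_measurable (lebesgue_on \<Omega>)"
      using assms L2_diff(1)[of f \<Omega> "\<phi> j"] L2_diff(1)[of g \<Omega> "\<phi> j"] by (auto simp: L2_def)
    moreover have "AE x in lebesgue_on \<Omega>. (norm (f x - \<phi> j x))\<^sup>2 = (norm (g x - \<phi> j x))\<^sup>2"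
      using assms(3) by (rule eventually_mono) simp
    ultimately show ?thesis
      unfolding sq_norm_def by (rule integral_cong_AE)
  qed
  then have "approximates \<phi> g"
    using \<phi> by (simp add: approximates_def)
  with \<phi> show ?thesis
    using extension_limit assms LIMSEQ_unique by blast
qed

lemma extension_add:
  assumes "f \<in> L2 \<Omega>" "g \<in> L2 \<Omega>"
  shows "extension (\<lambda>x. f x + g x) = extension f + extension g"
proof -
  obtain \<phi> where \<phi>: "approximates \<phi> f"
    using approximates_exists[OF assms(1)] .
  obtain \<psi> where \<psi>: "approximates \<psi> g"
    using approximates_exists[OF assms(2)] .
  have tests: "\<And>i. \<phi> i \<in> test_functions \<Omega>" "\<And>j. \<psi> j \<in> test_functions \<Omega>"
    using \<phi> \<psi> by (auto simp: approximates_def)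
  have bound: "sq_norm \<Omega> (\<lambda>x. f x + g x - (\<phi> j x + \<psi> j x))
      \<le> 2 * sq_norm \<Omega> (\<lambda>x. f x - \<phi> j x) + 2 * sq_norm \<Omega> (\<lambda>x. g x - \<psi> j x)" for j
    using L2_add(2)[OF L2_diff(1)[OF assms(1) test_L2[OF tests(1)[of j]]] L2_diff(1)[OF assms(2) test_L2[OF tests(2)[of j]]]]
    by (simp add: algebra_simps)
  have "(\<lambda>j. 2 * sq_norm \<Omega> (\<lambda>x. f x - \<phi> j x) + 2 * sq_norm \<Omega> (\<lambda>x. g x - \<psi> j x)) \<longlonglongrightarrow> 2 * 0 + 2 * 0"
    using \<phi> \<psi> by (intro tendsto_intros) (auto simp: approximates_def)
  then have "(\<lambda>j. 2 * sq_norm \<Omega> (\<lambda>x. f x - \<phi> j x) + 2 * sq_norm \<Omega> (\<lambda>x. g x - \<psi> j x)) \<longlonglongrightarrow> 0"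
    by simp
  then have "(\<lambda>j. sq_norm \<Omega> (\<lambda>x. f x + g x - (\<phi> j x + \<psi> j x))) \<longlonglongrightarrow> 0"
    by (rule tendsto_sandwich[OF always_eventually always_eventually tendsto_const, rotated 2])
      (auto simp: sq_norm_nonneg bound)
  then have "approximates (\<lambda>j x. \<phi> j x + \<psi> j x) (\<lambda>x. f x + g x)"
    using test_functions_add[OF tests] by (simp add: approximates_def)
  from extension_limit[OF L2_add(1)[OF assms] this]
  have "(\<lambda>j. J (\<phi> j) + J (\<psi> j)) \<longlonglongrightarrow> extension (\<lambda>x. f x + g x)"
    by (simp add: J_add tests)
  moreover have "(\<lambda>j. J (\<phi> j) + J (\<psi> j)) \<longlonglongrightarrow> extension f + extension g"
    by (intro tendsto_add extension_limit assms \<phi> \<psi>)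
  ultimately show ?thesis
    by (rule LIMSEQ_unique)
qed

lemma extension_scaleR:
  assumes "f \<in> L2 \<Omega>"
  shows "extension (\<lambda>x. c *\<^sub>R f x) = c *\<^sub>R extension f"
proof -
  obtain \<phi> where \<phi>: "approximates \<phi> f"
    using approximates_exists[OF assms] .
  have tests: "\<phi> j \<in> test_functions \<Omega>" for j
    using \<phi> by (auto simp: approximates_def)
  have "sq_norm \<Omega> (\<lambda>x. c *\<^sub>R f x - c *\<^sub>R \<phi> j x) = c\<^sup>2 * sq_norm \<Omega> (\<lambda>x. f x - \<phi> j x)" for j
    using L2_scaleR(2)[OF L2_diff(1)[OF assms test_L2[OF tests[of j]]], of c] by (simp add: scaleR_diff_right)
  moreover have "(\<lambda>j. c\<^sup>2 * sq_norm \<Omega> (\<lambda>x. f x - \<phi> j x)) \<longlonglongrightarrow> 0"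
    using \<phi> by (intro tendsto_mult_right_zero) (simp add: approximates_def)
  ultimately have "approximates (\<lambda>j x. c *\<^sub>R \<phi> j x) (\<lambda>x. c *\<^sub>R f x)"
    using test_functions_bounded_linear[OF bounded_linear_scaleR_right tests] by (simp add: approximates_def)
  from extension_limit[OF L2_scaleR(1)[OF assms] this]
  have "(\<lambda>j. c *\<^sub>R J (\<phi> j)) \<longlonglongrightarrow> extension (\<lambda>x. c *\<^sub>R f x)"
    by (simp add: J_scaleR tests)
  moreover have "(\<lambda>j. c *\<^sub>R J (\<phi> j)) \<longlonglongrightarrow> c *\<^sub>R extension f"
    by (intro tendsto_scaleR tendsto_const extension_limit assms \<phi>)
  ultimately show ?thesis
    by (rule LIMSEQ_unique)
qed

text \<open>
  An approximating sequence of \<open>f\<close> eventually lies in a slightly larger ball, and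
  \<open>\<parallel>\<phi>\<parallel>\<^sup>2 \<le> 2\<parallel>f\<parallel>\<^sup>2 + 2\<parallel>f - \<phi>\<parallel>\<^sup>2\<close> gives the radius.
\<close>

lemma extension_in_closure:
  assumes f: "f \<in> L2 \<Omega>" and "L2_norm_on \<Omega> f \<le> C"
  shows "extension f \<in> closure (J ` {\<phi> \<in> test_functions \<Omega>. sq_norm \<Omega> \<phi> \<le> 2 * C\<^sup>2 + 2})"
    (is "_ \<in> closure (J ` ?S)")
proof -
  obtain \<phi> where \<phi>: "approximates \<phi> f"
    using approximates_exists[OF f] .
  have "sq_norm \<Omega> f = (L2_norm_on \<Omega> f)\<^sup>2"
    by (simp add: L2_norm_on_def sq_norm_def)
  also have "\<dots> \<le> C\<^sup>2"
    using assms(2) by (rule power_mono) (simp add: L2_norm_on_def)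
  finally have f_le: "sq_norm \<Omega> f \<le> C\<^sup>2" .
  have "eventually (\<lambda>j. sq_norm \<Omega> (\<lambda>x. f x - \<phi> j x) < 1) sequentially"
    using \<phi> order_tendstoD(2)[OF _ zero_less_one] unfolding approximates_def by blast
  then have "eventually (\<lambda>j. J (\<phi> j) \<in> closure (J ` ?S)) sequentially"
  proof (rule eventually_mono)
    fix j assume j: "sq_norm \<Omega> (\<lambda>x. f x - \<phi> j x) < 1"
    have t: "\<phi> j \<in> test_functions \<Omega>"
      using \<phi> by (simp add: approximates_def)
    have "sq_norm \<Omega> (\<lambda>x. f x - (f x - \<phi> j x)) \<le> 2 * sq_norm \<Omega> f + 2 * sq_norm \<Omega> (\<lambda>x. f x - \<phi> j x)"
      by (rule L2_diff(2)[OF f L2_diff(1)[OF f test_L2[OF t]]])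
    then have "sq_norm \<Omega> (\<phi> j) \<le> 2 * C\<^sup>2 + 2"
      using j f_le by simp
    with t show "J (\<phi> j) \<in> closure (J ` ?S)"
      using closure_subset[of "J ` ?S"] by auto
  qed
  then show ?thesis
    by (rule Lim_in_closed_set[OF closed_closure _ sequentially_bot extension_limit[OF f \<phi>]])
qed

proposition J_compactly_embedded: "L2_compactly_embedded \<Omega> J"
  unfolding L2_compactly_embedded_def compact_operator_on_L2_def
proof (intro exI[of _ extension] conjI allI ballI impI)
  fix B :: "('a \<Rightarrow> 'b) set" and C assume B: "B \<subseteq> L2 \<Omega> \<and> (\<forall>f\<in>B. L2_norm_on \<Omega> f \<le> C)"
  let ?K = "closure (J ` {\<phi> \<in> test_functions \<Omega>. sq_norm \<Omega> \<phi> \<le> 2 * C\<^sup>2 + 2})"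
  have "closure (extension ` B) \<subseteq> ?K"
    using B extension_in_closure by (intro closure_minimal) auto
  then have "?K \<inter> closure (extension ` B) = closure (extension ` B)"
    by (rule Int_absorb1)
  moreover have "compact (?K \<inter> closure (extension ` B))"
    by (rule compact_Int_closed[OF compact_closure_image_J closed_closure])
  ultimately show "compact (closure (extension ` B))"
    by (simp only:)
next
  show "f \<in> L2 \<Omega> \<Longrightarrow> g \<in> L2 \<Omega> \<Longrightarrow> AE x in lebesgue_on \<Omega>. f x = g x \<Longrightarrow> extension f = extension g" for f g
    by (rule extension_AE_cong)
qed (simp_all add: extension_add extension_scaleR extension_test_function)

end

theorem proposition2:
  fixes \<Omega> :: "(real^'n) set"
    and A' :: "real \<Rightarrow> real"
    and A :: "real^'n \<Rightarrow> real^'n \<Rightarrow> real"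
    and L :: "real^'n \<Rightarrow> real"
    and J :: "(real^'n \<Rightarrow> real^'n) \<Rightarrow> 'h::{real_inner,complete_space}"
  assumes "CARD('n) \<in> {1, 2, 3}"
    and "bounded \<Omega>" and "open \<Omega>" and "connected \<Omega>" and "lipschitz_boundary \<Omega>"
    and "\<And>t. A' (- t) = A' t"
    and "\<And>x x'. A x x' = A' (norm (x - x'))"
    and "integrable (lebesgue_on (\<Omega> \<times> \<Omega>)) (\<lambda>(x, x'). A x x')"
    and "strictly_positive_definite \<Omega> A"
    and "twice_weakly_differentiable_on {x - x' | x x'. x \<in> \<Omega> \<and> x' \<in> \<Omega>} (\<lambda>d. A' (norm d))"
    and "has_weak_laplacian {x - x' | x x'. x \<in> \<Omega> \<and> x' \<in> \<Omega>} (\<lambda>d. A' (norm d)) L"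
    and "(\<lambda>(x, x'). L (x - x')) \<in> L2 (\<Omega> \<times> \<Omega>)"
    and "hilbert_completion (test_functions \<Omega>) (kernel_inner \<Omega> A) J"
  shows "L2_compactly_embedded \<Omega> J"
proof -
  have A: "A = (\<lambda>x x'. A' (norm (x - x')))"
    using assms(7) by blast
  have L: "(\<lambda>z. L (fst z - snd z)) \<in> L2 (\<Omega> \<times> \<Omega>)"
    using assms(12) by (simp add: case_prod_unfold)
  interpret L2_kernel_energy \<Omega> "\<lambda>z. - L (fst z - snd z)" J
  proof
    show "(\<lambda>z. - L (fst z - snd z)) \<in> L2 (\<Omega> \<times> \<Omega>)"
      using L2_scaleR(1)[OF L, of "-1"] by simp
    fix u :: "real^'n \<Rightarrow> real^'n"
    assume u: "u \<in> test_functions \<Omega>"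
    have "(norm (J u))\<^sup>2 = kernel_inner \<Omega> A u u"
      using assms(13) u by (simp add: hilbert_completion_def power2_norm_eq_inner)
    also have "\<dots> = kernel_form \<Omega> (\<lambda>z. - L (fst z - snd z)) u"
      unfolding A kernel_form_def
      by (simp add: kernel_inner_eq_laplacian_form[OF assms(11,3) u u])
    finally show "(norm (J u))\<^sup>2 = kernel_form \<Omega> (\<lambda>z. - L (fst z - snd z)) u" .
  qed (use assms(2,3,13) in \<open>auto simp: hilbert_completion_def\<close>)
  show ?thesis
    by (rule J_compactly_embedded)
qed

end
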